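(* Let $\{X_n\}_{n\ge0}$ be an irreducible aperiodic Markov chain with finite state space $\Sigma$, one-step transition matrix $\boldsymbol{P}=(P_{ij})_{i,j\in\Sigma}$, unique stationary distribution $\boldsymbol{\pi}=(\pi_i)_{i\in\Sigma}$, and arbitrary initial distribution (i.e. the distribution of $X_0$ is arbitrary). Let $w:\Sigma\times\Sigma\to\mathbf{R}$ be an arbitrary function, and put $\xi_n:=w(X_{n-1},X_n)$ and $S_n:=\xi_1+\cdots+\xi_n$ for $n\ge1$. Define $$\mu:=\sum_{i,j}\pi_iP_{ij}w(i,j)$$ and $$\sigma^2:=\sum_{i,j}\pi_iP_{ij}w(i,j)^2-\Big(\sum_{i,j}\pi_iP_{ij}w(i,j)\Big)^2+2\sum_{i,j,k,l}\pi_iP_{ij}w(i,j)(z_{jk}-\pi_k)P_{kl}w(k,l),$$ where $\boldsymbol{Z}=(z_{ij})$ is the fundamental matrix associated with $\boldsymbol{P}$. Then $$\lim_{n\to\infty}n^{-1}\mathrm{E}[S_n]=\mu\quad\text{and}\quad\frac{S_n}{n}\to\mu\ \text{ a.s.},$$ and, if $\sigma^2>0$, $$\lim_{n\to\infty}n^{-1}\mathrm{Var}(S_n)=\sigma^2\quad\text{and}\quad\frac{S_n-n\mu}{\sqrt{n\sigma^2}}\to_d N(0,1).$$ If $\mu=0$ and $\sigma^2>0$, then $$-\infty=\liminf_{n\to\infty}S_n<\limsup_{n\to\infty}S_n=\infty\ \text{ a.s.}$$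
   Context: Convention: $P_{ij}=\mathrm{P}(X_n=j\mid X_{n-1}=i)$ (row sums equal 1). The fundamental matrix associated with $\boldsymbol{P}$ is $\boldsymbol{Z}:=\boldsymbol{I}+\sum_{n=1}^\infty(\boldsymbol{P}^n-\boldsymbol{\Pi})=(\boldsymbol{I}-(\boldsymbol{P}-\boldsymbol{\Pi}))^{-1}$, where $\boldsymbol{\Pi}$ is the square matrix each of whose rows is $\boldsymbol{\pi}$. $\to_d$ denotes convergence in distribution. *)

theory Defs
  imports "HOL-Probability.Probability"
begin

text \<open>
  The finite state space is the index type \<open>'s\<close>; matrices are indexed as \<open>P $ i $ j\<close>, the
  probability of moving from \<open>i\<close> to \<open>j\<close>.  Distributions on the state space are row vectors.
\<close>

text \<open>The operation \<open>^\<close> is not available for \<open>real ^ 's ^ 's\<close> as the matrix power.\<close>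

primrec mat_power :: "real ^ 's ^ 's \<Rightarrow> nat \<Rightarrow> real ^ 's ^ 's" where
  "mat_power A 0 = mat 1"
| "mat_power A (Suc n) = A ** mat_power A n"

definition transition_matrix :: "real ^ 's ^ 's \<Rightarrow> bool" where
  "transition_matrix P \<longleftrightarrow> (\<forall>i j. 0 \<le> P $ i $ j) \<and> (\<forall>i. (\<Sum>j\<in>UNIV. P $ i $ j) = 1)"

definition irreducible_chain :: "real ^ 's ^ 's \<Rightarrow> bool" where
  "irreducible_chain P \<longleftrightarrow> (\<forall>i j. \<exists>n. 0 < mat_power P n $ i $ j)"

definition state_period :: "real ^ 's ^ 's \<Rightarrow> 's \<Rightarrow> nat" where
  "state_period P i = Gcd {n. 0 < n \<and> 0 < mat_power P n $ i $ i}"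

definition aperiodic_chain :: "real ^ 's ^ 's \<Rightarrow> bool" where
  "aperiodic_chain P \<longleftrightarrow> (\<forall>i. state_period P i = 1)"

definition stationary_distribution :: "real ^ 's ^ 's \<Rightarrow> real ^ 's \<Rightarrow> bool" where
  "stationary_distribution P p \<longleftrightarrow>
     (\<forall>i. 0 \<le> p $ i) \<and> (\<Sum>i\<in>UNIV. p $ i) = 1 \<and> p v* P = p"

text \<open>
  The Markov property is required only for histories of positive probability, as \<open>cond_prob\<close> is
  \<open>0\<close> when the conditioning event is null.  The distribution of \<open>X 0\<close> is unrestricted.
\<close>

definition markov_chain :: "'a measure \<Rightarrow> real ^ 's ^ 's \<Rightarrow> (nat \<Rightarrow> 'a \<Rightarrow> 's) \<Rightarrow> bool" where
  "markov_chain M P X \<longleftrightarrow>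
     prob_space M \<and> transition_matrix P \<and>
     (\<forall>n. X n \<in> measurable M (count_space UNIV)) \<and>
     (\<forall>n x. 0 < \<P>(\<omega> in M. \<forall>m\<le>n. X m \<omega> = x m) \<longrightarrow>
        (\<forall>j. \<P>(\<omega> in M. X (Suc n) \<omega> = j \<bar> \<forall>m\<le>n. X m \<omega> = x m) = P $ x n $ j))"

definition fundamental_matrix :: "real ^ 's ^ 's \<Rightarrow> real ^ 's \<Rightarrow> real ^ 's ^ 's" where
  "fundamental_matrix P p = mat 1 + (\<Sum>n. mat_power P (Suc n) - (\<chi> i. p))"

definition asymptotic_mean ::
    "real ^ 's ^ 's \<Rightarrow> real ^ 's \<Rightarrow> ('s \<Rightarrow> 's \<Rightarrow> real) \<Rightarrow> real" where
  "asymptotic_mean P p w = (\<Sum>i\<in>UNIV. \<Sum>j\<in>UNIV. p $ i * P $ i $ j * w i j)"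

definition asymptotic_variance ::
    "real ^ 's ^ 's \<Rightarrow> real ^ 's \<Rightarrow> ('s \<Rightarrow> 's \<Rightarrow> real) \<Rightarrow> real" where
  "asymptotic_variance P p w =
     (\<Sum>i\<in>UNIV. \<Sum>j\<in>UNIV. p $ i * P $ i $ j * (w i j)\<^sup>2)
     - (\<Sum>i\<in>UNIV. \<Sum>j\<in>UNIV. p $ i * P $ i $ j * w i j)\<^sup>2
     + 2 * (\<Sum>i\<in>UNIV. \<Sum>j\<in>UNIV. \<Sum>k\<in>UNIV. \<Sum>l\<in>UNIV.
         p $ i * P $ i $ j * w i j * (fundamental_matrix P p $ j $ k - p $ k) * P $ k $ l * w k l)"

definition partial_sum ::
    "(nat \<Rightarrow> 'a \<Rightarrow> 's) \<Rightarrow> ('s \<Rightarrow> 's \<Rightarrow> real) \<Rightarrow> nat \<Rightarrow> 'a \<Rightarrow> real" where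
  "partial_sum X w n \<omega> = (\<Sum>m=1..n. w (X (m - 1) \<omega>) (X m \<omega>))"

end

theory Submission
  imports Defs "HOL-Real_Asymp.Real_Asymp"
begin

text \<open>
  With \<open>h = Z g\<close>, where \<open>g i = (\<Sum>j. P i j * w i j) - \<mu>\<close>, the Poisson equation \<open>h - P h = g\<close> gives
  \<open>S n - n \<mu> = W n + h (X 0) - h (X n)\<close> for the martingale \<open>W\<close> with the bounded differences
  \<open>d i j = w i j - \<mu> + h j - h i\<close>, and \<open>\<sigma>\<^sup>2\<close> is the stationary mean of \<open>q i = (\<Sum>j. P i j * (d i j)\<^sup>2)\<close>.
  A second potential \<open>r\<close> with \<open>r - P r = q - \<sigma>\<^sup>2\<close> makes \<open>(W n)\<^sup>2 + r (X n) - n \<sigma>\<^sup>2\<close> a martingale, which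
  gives the variance.  The fourth moment bound \<open>E (W n)^4 = O(n\<^sup>2)\<close> gives the strong law, and
  \<open>1 - \<theta>\<^sup>2 r / 2\<close> is an approximate eigenfunction of the kernel \<open>P i j * exp (\<i> \<theta> d i j)\<close> with eigenvalue
  \<open>1 - \<theta>\<^sup>2 \<sigma>\<^sup>2 / 2\<close>, which gives the central limit theorem.  For the oscillation, the second and fourth
  conditional moments bound from below the conditional probability that an increment over a time
  interval of length \<open>k\<close> exceeds a multiple of \<open>\<surd>k\<close>; no zero-one law is needed.
\<close>

subsection \<open>Geometric ergodicity and the Poisson equation\<close>

text \<open>The initial law is arbitrary, so expectations at time \<open>n\<close> are not averages
  over \<open>p\<close>, and the conditional variance of the next increment of \<open>W\<close>
  varies with the current state. The potential \<open>r\<close> trades this fluctuation for bounded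
  boundary terms, so that the variance, the characteristic function and the oscillation bound all
  involve one constant \<open>s\<close>. Conditioning on the past appears only as a weight: instead
  of conditional expectations there are integrals of \<open>Y \<omega> * ...\<close> with
  \<open>Y\<close> a function of \<open>X 0, ..., X m\<close>. Such a \<open>Y\<close> takes
  finitely many values, so integrability is automatic. Second and fourth moments alone cannot tell
  an upward increment from a downward one; since the conditional mean is zero, a linear term can be
  added at no cost, and it makes the oscillation argument one-sided. The other direction follows by
  negating \<open>d\<close>, which leaves its squares and hence \<open>r\<close> unchanged.
  Aperiodicity enters through the summability of the deviations of the matrix powers from their
  limit, on which \<open>Z\<close> rests.\<close>

lemma eventually_in_additive_set:
  fixes A :: "nat set"
  assumes add: "\<And>a b. a \<in> A \<Longrightarrow> b \<in> A \<Longrightarrow> a + b \<in> A" and gcd: "Gcd A = 1"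
  shows "\<exists>N. \<forall>n\<ge>N. n \<in> A"
proof -
  define B where "B = insert 0 A"
  have B_add: "a + b \<in> B" if "a \<in> B" "b \<in> B" for a b
    using that add by (auto simp: B_def)
  have B_mult: "k * a \<in> B" if "a \<in> B" for k a
    by (induction k) (use that B_add in \<open>auto simp: B_def\<close>)
  \<comment> \<open>\<open>D\<close> collects the positive differences between elements of
    \<open>B\<close>. Its least element \<open>d\<close> divides all of \<open>A\<close>: a nonzero
    remainder \<open>a mod d\<close> would be a smaller difference, namely that of
    \<open>q * b + a\<close> and \<open>q * (b + d)\<close>.\<close>
  define D where "D = {d. 0 < d \<and> (\<exists>b\<in>B. b + d \<in> B)}"
  have "\<exists>a\<in>A. a \<noteq> 0"
  proof (rule ccontr)
    assume "\<not> ?thesis"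
    then have "Gcd A = 0" by (simp add: Gcd_0_iff subset_iff)
    with gcd show False by simp
  qed
  then obtain a0 where a0: "a0 \<in> A" "0 < a0" by auto
  then have "a0 \<in> D" by (auto simp: D_def B_def)
  define d where "d = (LEAST d. d \<in> D)"
  have dD: "d \<in> D" unfolding d_def using \<open>a0 \<in> D\<close> by (rule LeastI)
  have least: "d \<le> e" if "e \<in> D" for e unfolding d_def using that by (rule Least_le)
  from dD obtain b where b: "b \<in> B" "b + d \<in> B" "0 < d" by (auto simp: D_def)
  have "d dvd a" if "a \<in> A" for a
  proof (rule ccontr)
    assume "\<not> d dvd a"
    then have pos: "0 < a mod d" by (simp add: dvd_eq_mod_eq_0)
    define q where "q = a div d"
    have aq: "a = q * d + a mod d" by (simp add: q_def)
    have "a \<in> B" using that by (simp add: B_def)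
    then have "q * b + a \<in> B" using b(1) by (intro B_add B_mult)
    moreover have "q * b + a = q * (b + d) + a mod d"
      by (subst aq) (simp add: algebra_simps)
    ultimately have "q * (b + d) + a mod d \<in> B" by simp
    then have "a mod d \<in> D" using pos B_mult[OF b(2)] by (auto simp: D_def)
    from least[OF this] mod_less_divisor[OF b(3), of a] show False by simp
  qed
  then have "d dvd Gcd A" by (rule Gcd_greatest)
  with gcd have d1: "d = 1" by simp
  \<comment> \<open>\<open>B\<close> contains \<open>b\<close> and \<open>b + 1\<close>. In
    \<open>n = q * b + s\<close>, replace \<open>s\<close> of the \<open>q\<close> copies of
    \<open>b\<close> by \<open>b + 1\<close>; this needs \<open>s \<le> q\<close>, which
    \<open>n \<ge> b * b\<close> ensures. The successor excludes \<open>n = 0\<close>, the element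
    that was added to \<open>A\<close>.\<close>
  have "n \<in> A" if n: "n \<ge> Suc (b * b)" for n
  proof (cases "b = 0")
    case True
    with b d1 have "1 \<in> B" by simp
    from B_mult[OF this, of n] n show ?thesis by (auto simp: B_def)
  next
    case False
    define q where "q = n div b"
    define s where "s = n mod b"
    have nq: "n = q * b + s" by (simp add: q_def s_def)
    have "s < b" using False by (simp add: s_def)
    moreover have "b \<le> q" unfolding q_def using n False
      by (metis Suc_leD div_le_mono nonzero_mult_div_cancel_right)
    ultimately have "s \<le> q" by simp
    then have "n = (q - s) * b + s * (b + d)"
      unfolding nq d1 by (simp add: algebra_simps diff_mult_distrib)
    then have "n \<in> B" using B_add B_mult b by simp
    with n show ?thesis by (auto simp: B_def)
  qed
  then show ?thesis by blast
qed

lemma mat_power_add: "mat_power A (m + n) = mat_power A m ** mat_power A n"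
  for A :: "real ^ 's::finite ^ 's"
  by (induction m) (auto simp: matrix_mul_assoc)

lemma finite_bound:
  fixes f :: "'i::finite \<Rightarrow> real"
  obtains B where "\<And>i. \<bar>f i\<bar> \<le> B"
proof
  show "\<bar>f i\<bar> \<le> Max (range (\<lambda>i. \<bar>f i\<bar>))" for i by (rule Max_ge) auto
qed

lemma partial_sum_0: "partial_sum X w 0 \<omega> = 0"
  and partial_sum_Suc: "partial_sum X w (Suc n) \<omega> = partial_sum X w n \<omega> + w (X n \<omega>) (X (Suc n) \<omega>)"
  by (simp_all add: partial_sum_def)

lemma partial_sum_bound:
  assumes "\<And>i j. \<bar>w i j\<bar> \<le> c"
  shows "\<bar>partial_sum X w (m + k) \<omega> - partial_sum X w m \<omega>\<bar> \<le> real k * c"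
proof (induction k)
  case (Suc k)
  then show ?case
    using assms[of "X (m + k) \<omega>" "X (Suc (m + k)) \<omega>"] by (simp add: partial_sum_Suc algebra_simps)
qed simp

section \<open>Primitivity and convergence of the powers of \<open>P\<close>\<close>

locale ergodic_chain =
  fixes P :: "real ^ 's::finite ^ 's" and p :: "real ^ 's"
  assumes trans: "transition_matrix P"
    and irred: "irreducible_chain P"
    and aper: "aperiodic_chain P"
    and stat: "stationary_distribution P p"
begin

lemma P_nonneg: "0 \<le> P $ i $ j" and P_row: "(\<Sum>j\<in>UNIV. P $ i $ j) = 1"
  using trans by (auto simp: transition_matrix_def)

lemma p_nonneg: "0 \<le> p $ i" and p_sum: "(\<Sum>i\<in>UNIV. p $ i) = 1"
  using stat by (auto simp: stationary_distribution_def)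

lemma p_stat: "(\<Sum>i\<in>UNIV. p $ i * P $ i $ j) = p $ j"
proof -
  have "(p v* P) $ j = p $ j" using stat by (simp add: stationary_distribution_def)
  then show ?thesis by (simp add: vector_matrix_mult_def mult.commute)
qed

lemma p_le_1: "p $ i \<le> 1"
  using member_le_sum[of i UNIV "\<lambda>i. p $ i"] p_nonneg p_sum by simp

abbreviation Pn :: "nat \<Rightarrow> 's \<Rightarrow> 's \<Rightarrow> real" where "Pn n i j \<equiv> mat_power P n $ i $ j"

lemma Pn_Suc: "Pn (Suc n) i j = (\<Sum>k\<in>UNIV. P $ i $ k * Pn n k j)"
  by (simp add: matrix_matrix_mult_def)

lemma Pn_add: "Pn (m + n) i j = (\<Sum>k\<in>UNIV. Pn m i k * Pn n k j)"
  by (simp add: mat_power_add matrix_matrix_mult_def)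

lemma Pn_nonneg: "0 \<le> Pn n i j"
proof (induction n arbitrary: i)
  case 0 show ?case by (simp add: mat_def)
next
  case (Suc n) then show ?case unfolding Pn_Suc by (intro sum_nonneg mult_nonneg_nonneg P_nonneg)
qed

lemma Pn_row: "(\<Sum>j\<in>UNIV. Pn n i j) = 1"
proof (induction n arbitrary: i)
  case 0 show ?case by (simp add: mat_def)
next
  case (Suc n)
  have "(\<Sum>j\<in>UNIV. Pn (Suc n) i j) = (\<Sum>k\<in>UNIV. P $ i $ k * (\<Sum>j\<in>UNIV. Pn n k j))"
    unfolding Pn_Suc by (subst sum.swap) (simp add: sum_distrib_left)
  then show ?case by (simp add: Suc P_row)
qed

lemma p_Pn: "(\<Sum>i\<in>UNIV. p $ i * Pn n i j) = p $ j"
proof (induction n)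
  case 0 show ?case by (simp add: mat_def if_distrib cong: if_cong)
next
  case (Suc n)
  have "(\<Sum>i\<in>UNIV. p $ i * Pn (Suc n) i j) = (\<Sum>k\<in>UNIV. (\<Sum>i\<in>UNIV. p $ i * P $ i $ k) * Pn n k j)"
    unfolding Pn_Suc sum_distrib_left sum_distrib_right mult.assoc by (rule sum.swap)
  then show ?case by (simp add: p_stat Suc)
qed

lemma Pn_mono: "Pn m i k * Pn n k j \<le> Pn (m + n) i j"
  unfolding Pn_add using member_le_sum[of k UNIV "\<lambda>k. Pn m i k * Pn n k j"] by (simp add: Pn_nonneg)

lemma Pn_pos_add: "0 < Pn m i k \<Longrightarrow> 0 < Pn n k j \<Longrightarrow> 0 < Pn (m + n) i j"
  using Pn_mono[of m i k n j] by (metis less_le_trans mult_pos_pos)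

text \<open>Return times to \<open>i\<close> are closed under addition and have gcd 1, so all large
  times are return times; appending one fixed path from \<open>i\<close> to \<open>j\<close> gives
  positivity at all large times. The finitely many pairs then share a time.\<close>

lemma primitive: obtains N where "\<And>i j. 0 < Pn N i j"
proof -
  have "\<exists>N. \<forall>n\<ge>N. 0 < Pn n i j" for i j
  proof -
    obtain m where m: "0 < Pn m i j" using irred by (auto simp: irreducible_chain_def)
    let ?A = "{n. 0 < n \<and> 0 < Pn n i i}"
    have "\<exists>N. \<forall>n\<ge>N. n \<in> ?A"
      using aper by (intro eventually_in_additive_set)
        (auto intro: Pn_pos_add simp: aperiodic_chain_def state_period_def)
    then obtain N where N: "\<And>n. n \<ge> N \<Longrightarrow> 0 < Pn n i i" by auto
    have "0 < Pn n i j" if "n \<ge> N + m" for n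
      using Pn_pos_add[OF N[of "n - m"] m] that by simp
    then show ?thesis by blast
  qed
  then obtain f where f: "\<And>i j n. n \<ge> f i j \<Longrightarrow> 0 < Pn n i j" by metis
  define N where "N = (\<Sum>i\<in>UNIV. \<Sum>j\<in>UNIV. f i j)"
  have "f i j \<le> N" for i j
  proof -
    have "f i j \<le> (\<Sum>j\<in>UNIV. f i j)" by (rule member_le_sum) auto
    also have "\<dots> \<le> (\<Sum>i\<in>UNIV. \<Sum>j\<in>UNIV. f i j)"
      by (rule member_le_sum[of i UNIV "\<lambda>i. \<Sum>j\<in>UNIV. f i j"]) auto
    finally show ?thesis by (simp add: N_def)
  qed
  then have "0 < Pn N i j" for i j using f by blast
  then show ?thesis by (rule that)
qed

text \<open>Doeblin's argument: \<open>P^(N+n) - \<Pi> = (P^N - a \<Pi>) (P^n - \<Pi>)\<close>, where \<open>P^N - a \<Pi>\<close> is nonnegative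
  with row sums \<open>1 - a\<close>.\<close>

lemma summable_deviation: "summable (\<lambda>n. \<bar>Pn n i j - p $ j\<bar>)"
proof -
  obtain N where N: "\<And>i j. 0 < Pn N i j" using primitive by blast
  define a where "a = Min (range (\<lambda>(i, j). Pn N i j))"
  have a_le: "a \<le> Pn N i j" for i j
    unfolding a_def by (rule Min_le) auto
  have "a \<in> range (\<lambda>(i, j). Pn N i j)" unfolding a_def by (rule Min_in) auto
  then have a_pos: "0 < a" using N by auto
  define b where "b n = Max (range (\<lambda>i. \<bar>Pn n i j - p $ j\<bar>))" for n
  have le_b: "\<bar>Pn n i j - p $ j\<bar> \<le> b n" for n i unfolding b_def by (rule Max_ge) auto
  have b_nonneg: "0 \<le> b n" for n using le_b[of n i] abs_ge_zero order_trans by blast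
  have step: "b (N + n) \<le> (1 - a) * b n" for n
  proof -
    have "\<bar>Pn (N + n) k j - p $ j\<bar> \<le> (1 - a) * b n" for k
    proof -
      let ?R = "\<lambda>l. Pn N k l - a * p $ l"
      have R: "0 \<le> ?R l" for l
        using order_trans[OF mult_left_le[of "p $ l" a] a_le[of k l]] p_le_1[of l] a_pos by simp
      \<comment> \<open>Removing \<open>a * p $ l\<close> from the weights changes nothing, because
        by \<open>p_Pn\<close> the deviations have mean zero under \<open>p\<close>. The loss of
        mass \<open>a\<close> is the contraction.\<close>
      have "Pn (N + n) k j - p $ j = (\<Sum>l\<in>UNIV. ?R l * (Pn n l j - p $ j))"
      proof -
        have "(\<Sum>l\<in>UNIV. ?R l * (Pn n l j - p $ j)) =
          (\<Sum>l\<in>UNIV. Pn N k l * Pn n l j) - (\<Sum>l\<in>UNIV. Pn N k l) * p $ j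
            - a * (\<Sum>l\<in>UNIV. p $ l * Pn n l j) + a * (\<Sum>l\<in>UNIV. p $ l) * p $ j"
          by (simp add: algebra_simps sum.distrib sum_subtractf sum_distrib_left)
        then show ?thesis by (simp add: Pn_add Pn_row p_Pn p_sum)
      qed
      also have "\<bar>\<dots>\<bar> \<le> (\<Sum>l\<in>UNIV. \<bar>?R l * (Pn n l j - p $ j)\<bar>)" by (rule sum_abs)
      also have "\<dots> \<le> (\<Sum>l\<in>UNIV. ?R l * b n)"
        by (intro sum_mono) (simp only: abs_mult abs_of_nonneg[OF R], intro mult_left_mono le_b R)
      also have "\<dots> = (1 - a) * b n"
        by (simp add: sum_distrib_right[symmetric] sum_subtractf Pn_row sum_distrib_left[symmetric] p_sum)
      finally show ?thesis .
    qed
    then show ?thesis unfolding b_def[of "N + n"] by (subst Max_le_iff) auto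
  qed
  \<comment> \<open>The contraction acts across \<open>N\<close> steps. Splitting off the first
    \<open>N\<close> terms bounds \<open>a\<close> times any partial sum by the sum of these terms,
    so no geometric rate has to be extracted.\<close>
  have bdd: "(\<Sum>n<L. b n) \<le> (\<Sum>n<N. b n) / a" for L
  proof -
    have "(\<Sum>n<L. b n) \<le> (\<Sum>n<N + L. b n)" using b_nonneg by (intro sum_mono2) auto
    also have "\<dots> = (\<Sum>n<N. b n) + (\<Sum>n<L. b (N + n))"
      by (induction L) simp_all
    also have "(\<Sum>n<L. b (N + n)) \<le> (\<Sum>n<L. (1 - a) * b n)" by (intro sum_mono step)
    also have "\<dots> = (1 - a) * (\<Sum>n<L. b n)" by (simp add: sum_distrib_left)
    finally show ?thesis using a_pos by (simp add: field_simps)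
  qed
  have "summable b" by (rule summableI_nonneg_bounded[OF b_nonneg bdd])
  then show ?thesis by (rule summable_comparison_test') (use le_b in auto)
qed

section \<open>The fundamental matrix and its potentials\<close>

abbreviation Z :: "'s \<Rightarrow> 's \<Rightarrow> real" where "Z i j \<equiv> fundamental_matrix P p $ i $ j"

lemma summable_dev: "summable (\<lambda>n. Pn (n + k) i j - p $ j)"
  using summable_rabs_cancel[OF summable_deviation[of i j]] by (subst summable_iff_shift)

text \<open>The series in \<open>fundamental_matrix\<close> is summed in the space of matrices;
  convergence in each entry is what allows its value to be read off entrywise.\<close>

lemma Z_eq: "Z i j = (if i = j then 1 else 0) + (\<Sum>n. Pn (Suc n) i j - p $ j)"
proof -
  let ?D = "\<lambda>n. mat_power P (Suc n) - (\<chi> i. p)"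
  have "(\<lambda>n. (\<Sum>m<n. ?D m)) \<longlonglongrightarrow> (\<chi> i j. \<Sum>n. Pn (Suc n) i j - p $ j)"
  proof (intro vec_tendstoI)
    fix i j
    have "(\<lambda>n. \<Sum>m<n. Pn (Suc m) i j - p $ j) \<longlonglongrightarrow> (\<Sum>n. Pn (Suc n) i j - p $ j)"
      using summable_dev[of 1 i j] by (intro summable_LIMSEQ) simp
    then show "(\<lambda>n. (\<Sum>m<n. ?D m) $ i $ j)
        \<longlonglongrightarrow> (\<chi> i j. \<Sum>n. Pn (Suc n) i j - p $ j) $ i $ j"
      by (simp add: sum_component del: mat_power.simps)
  qed
  then have "?D sums (\<chi> i j. \<Sum>n. Pn (Suc n) i j - p $ j)" by (simp add: sums_def)
  from sums_unique[OF this, symmetric] show ?thesis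
    unfolding fundamental_matrix_def by (simp add: mat_def del: mat_power.simps)
qed

text \<open>Multiplication by \<open>P\<close> shifts the series by one place, as \<open>P\<close>
  fixes the matrix whose rows are all \<open>p\<close>. Only the identity and the head of the series
  survive in the difference.\<close>

lemma Z_poisson: "Z i k - (\<Sum>j\<in>UNIV. P $ i $ j * Z j k) = (if i = k then 1 else 0) - p $ k"
proof -
  have sm: "summable (\<lambda>n. Pn (Suc n) j k - p $ k)" for j using summable_dev[of 1] by simp
  have "(\<Sum>j\<in>UNIV. P $ i $ j * Z j k) =
    (\<Sum>j\<in>UNIV. P $ i $ j * (if j = k then 1 else 0)) +
    (\<Sum>j\<in>UNIV. P $ i $ j * (\<Sum>n. Pn (Suc n) j k - p $ k))"
    by (simp only: Z_eq distrib_left sum.distrib)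
  also have "(\<Sum>j\<in>UNIV. P $ i $ j * (if j = k then 1 else 0)) = P $ i $ k"
    by (simp add: if_distrib cong: if_cong)
  also have "(\<Sum>j\<in>UNIV. P $ i $ j * (\<Sum>n. Pn (Suc n) j k - p $ k)) =
     (\<Sum>n. \<Sum>j\<in>UNIV. P $ i $ j * (Pn (Suc n) j k - p $ k))"
    by (subst suminf_sum) (auto intro!: summable_mult sm sum.cong suminf_mult[symmetric] simp del: mat_power.simps)
  also have "\<dots> = (\<Sum>n. Pn (Suc (Suc n)) i k - p $ k)"
    by (intro suminf_cong) (simp add: Pn_Suc[of "Suc _"] right_diff_distrib sum_subtractf
        sum_distrib_right[symmetric] P_row del: mat_power.simps)
  also have "\<dots> = (\<Sum>n. Pn (Suc n) i k - p $ k) - (Pn (Suc 0) i k - p $ k)"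
    using suminf_split_head[OF sm[of i]] by simp
  finally show ?thesis by (simp add: Z_eq[of i k])
qed

text \<open>The deviations of the powers have row sums zero and are annihilated by \<open>p\<close>
  from the left. Hence only the identity contributes, here and in \<open>p_Z\<close>.\<close>

lemma Z_row: "(\<Sum>k\<in>UNIV. Z j k) = 1"
proof -
  have "(\<Sum>k\<in>UNIV. \<Sum>n. Pn (Suc n) j k - p $ k) = (\<Sum>n. \<Sum>k\<in>UNIV. Pn (Suc n) j k - p $ k)"
    using summable_dev[of 1] by (subst suminf_sum) (auto simp del: mat_power.simps)
  also have "\<dots> = 0" by (simp add: sum_subtractf Pn_row p_sum del: mat_power.simps)
  finally show ?thesis by (simp add: Z_eq sum.distrib del: mat_power.simps)
qed

lemma p_Z: "(\<Sum>j\<in>UNIV. p $ j * Z j k) = p $ k"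
proof -
  have sm: "summable (\<lambda>n. Pn (Suc n) j k - p $ k)" for j using summable_dev[of 1] by simp
  have "(\<Sum>j\<in>UNIV. p $ j * (\<Sum>n. Pn (Suc n) j k - p $ k)) =
     (\<Sum>n. \<Sum>j\<in>UNIV. p $ j * (Pn (Suc n) j k - p $ k))"
    by (subst suminf_sum) (auto intro!: summable_mult sm sum.cong suminf_mult[symmetric] simp del: mat_power.simps)
  also have "\<dots> = 0" by (simp add: right_diff_distrib sum_subtractf p_Pn
      sum_distrib_right[symmetric] p_sum del: mat_power.simps)
  finally have "(\<Sum>j\<in>UNIV. p $ j * Z j k) = (\<Sum>j\<in>UNIV. p $ j * (if j = k then 1 else 0))"
    by (simp only: Z_eq distrib_left sum.distrib)
  then show ?thesis by (simp add: if_distrib cong: if_cong)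
qed

definition potential :: "('s \<Rightarrow> real) \<Rightarrow> 's \<Rightarrow> real" where
  "potential g i = (\<Sum>k\<in>UNIV. Z i k * g k)"

lemma poisson_equation:
  assumes "(\<Sum>i\<in>UNIV. p $ i * g i) = 0"
  shows "potential g i - (\<Sum>j\<in>UNIV. P $ i $ j * potential g j) = g i"
proof -
  have "(\<Sum>j\<in>UNIV. P $ i $ j * potential g j) = (\<Sum>k\<in>UNIV. (\<Sum>j\<in>UNIV. P $ i $ j * Z j k) * g k)"
    unfolding potential_def sum_distrib_left sum_distrib_right mult.assoc by (rule sum.swap)
  then have "potential g i - (\<Sum>j\<in>UNIV. P $ i $ j * potential g j) =
    (\<Sum>k\<in>UNIV. (Z i k - (\<Sum>j\<in>UNIV. P $ i $ j * Z j k)) * g k)"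
    by (simp add: potential_def left_diff_distrib sum_subtractf)
  also have "\<dots> = g i"
    unfolding Z_poisson using assms
    by (simp add: left_diff_distrib sum_subtractf if_distrib[of "\<lambda>x. x * _"] cong: if_cong)
  finally show ?thesis .
qed

text \<open>For the centred \<open>drift w\<close> this gives the potential stationary mean zero,
  which removes \<mu> from the mixed term of the variance.\<close>

lemma p_potential: "(\<Sum>i\<in>UNIV. p $ i * potential g i) = (\<Sum>i\<in>UNIV. p $ i * g i)"
proof -
  have "(\<Sum>i\<in>UNIV. p $ i * potential g i) = (\<Sum>k\<in>UNIV. (\<Sum>i\<in>UNIV. p $ i * Z i k) * g k)"
    unfolding potential_def sum_distrib_left sum_distrib_right mult.assoc by (rule sum.swap)
  then show ?thesis by (simp add: p_Z)
qed

lemma stationary_average: "(\<Sum>i\<in>UNIV. p $ i * (\<Sum>j\<in>UNIV. P $ i $ j * f j)) = (\<Sum>j\<in>UNIV. p $ j * f j)"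
proof -
  have "(\<Sum>i\<in>UNIV. p $ i * (\<Sum>j\<in>UNIV. P $ i $ j * f j)) =
      (\<Sum>j\<in>UNIV. (\<Sum>i\<in>UNIV. p $ i * P $ i $ j) * f j)"
    unfolding sum_distrib_left sum_distrib_right mult.assoc by (rule sum.swap)
  then show ?thesis by (simp add: p_stat)
qed

section \<open>The martingale decomposition and the variance formula\<close>

lemma asymptotic_mean_eq:
  "asymptotic_mean P p w = (\<Sum>i\<in>UNIV. p $ i * (\<Sum>j\<in>UNIV. P $ i $ j * w i j))"
  by (simp add: asymptotic_mean_def sum_distrib_left mult.assoc)

definition drift :: "('s \<Rightarrow> 's \<Rightarrow> real) \<Rightarrow> 's \<Rightarrow> real" where
  "drift w i = (\<Sum>j\<in>UNIV. P $ i $ j * w i j) - asymptotic_mean P p w"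

definition martingale_part :: "('s \<Rightarrow> 's \<Rightarrow> real) \<Rightarrow> 's \<Rightarrow> 's \<Rightarrow> real" where
  "martingale_part w i j =
     w i j - asymptotic_mean P p w + potential (drift w) j - potential (drift w) i"

definition cond_variance :: "('s \<Rightarrow> 's \<Rightarrow> real) \<Rightarrow> 's \<Rightarrow> real" where
  "cond_variance w i = (\<Sum>j\<in>UNIV. P $ i $ j * (martingale_part w i j)\<^sup>2)"

lemma p_drift: "(\<Sum>i\<in>UNIV. p $ i * drift w i) = 0"
  by (simp add: drift_def right_diff_distrib sum_subtractf sum_distrib_right[symmetric] p_sum
      asymptotic_mean_eq)

lemma potential_drift: "potential (drift w) i = drift w i + (\<Sum>j\<in>UNIV. P $ i $ j * potential (drift w) j)"
  using poisson_equation[OF p_drift, of w i] by simp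

lemma martingale_part_centred: "(\<Sum>j\<in>UNIV. P $ i $ j * martingale_part w i j) = 0"
proof -
  have "(\<Sum>j\<in>UNIV. P $ i $ j * martingale_part w i j) =
      drift w i + (\<Sum>j\<in>UNIV. P $ i $ j * potential (drift w) j) - potential (drift w) i"
    by (simp add: martingale_part_def drift_def distrib_left right_diff_distrib sum.distrib
        sum_subtractf sum_distrib_right[symmetric] P_row)
  then show ?thesis using potential_drift[of w i] by simp
qed

text \<open>By the Poisson equation, in the form \<open>hi\<close>, the terms of the expanded square
  that are linear in \<open>h i\<close> add up to a multiple of \<open>(h i)\<^sup>2\<close>. What
  remains of the squares of \<open>h\<close> cancels under averaging over \<open>p\<close>.\<close>

lemma cond_variance_eq:
  fixes w
  defines "v \<equiv> \<lambda>i j. w i j - asymptotic_mean P p w" and "h \<equiv> potential (drift w)"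
  shows "cond_variance w i = (\<Sum>j\<in>UNIV. P $ i $ j * (v i j)\<^sup>2) + 2 * (\<Sum>j\<in>UNIV. P $ i $ j * (v i j * h j))
    + (\<Sum>j\<in>UNIV. P $ i $ j * (h j)\<^sup>2) - (h i)\<^sup>2"
proof -
  have hi: "(\<Sum>j\<in>UNIV. P $ i $ j * (v i j + h j)) = h i"
    using potential_drift[of w i]
    by (simp add: v_def h_def drift_def distrib_left right_diff_distrib sum.distrib
        sum_subtractf sum_distrib_right[symmetric] P_row)
  have "cond_variance w i = (\<Sum>j\<in>UNIV. P $ i $ j * (v i j)\<^sup>2 + 2 * (P $ i $ j * (v i j * h j))
    + P $ i $ j * (h j)\<^sup>2 - 2 * h i * (P $ i $ j * (v i j + h j)) + P $ i $ j * (h i)\<^sup>2)"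
    unfolding cond_variance_def martingale_part_def v_def h_def
    by (intro sum.cong) (auto simp: power2_eq_square algebra_simps)
  also have "\<dots> = (\<Sum>j\<in>UNIV. P $ i $ j * (v i j)\<^sup>2) + 2 * (\<Sum>j\<in>UNIV. P $ i $ j * (v i j * h j))
    + (\<Sum>j\<in>UNIV. P $ i $ j * (h j)\<^sup>2) - 2 * h i * h i + (h i)\<^sup>2"
    unfolding hi[symmetric] by (simp only: sum.distrib sum_subtractf sum_distrib_left[symmetric]
        sum_distrib_right[symmetric] P_row hi mult_1_left)
  finally show ?thesis by (simp add: power2_eq_square)
qed

text \<open>The coefficients \<open>Z j k - p $ k\<close> of the variance formula arise here: the
  rows of \<open>Z\<close> sum to 1, so centring by \<mu> can be moved from the function to the
  matrix.\<close>

lemma potential_drift_eq: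
  "potential (drift w) j = (\<Sum>k\<in>UNIV. (Z j k - p $ k) * (\<Sum>l\<in>UNIV. P $ k $ l * w k l))"
proof -
  have "(\<Sum>k\<in>UNIV. (Z j k - p $ k) * (\<Sum>l\<in>UNIV. P $ k $ l * w k l)) =
     (\<Sum>k\<in>UNIV. Z j k * drift w k) + (\<Sum>k\<in>UNIV. Z j k) * asymptotic_mean P p w
      - (\<Sum>k\<in>UNIV. p $ k * (\<Sum>l\<in>UNIV. P $ k $ l * w k l))"
    unfolding sum_distrib_right sum.distrib[symmetric] sum_subtractf[symmetric]
    by (intro sum.cong) (auto simp: drift_def algebra_simps)
  then show ?thesis by (simp add: Z_row potential_def asymptotic_mean_eq)
qed

text \<open>When \<open>cond_variance_eq\<close> is averaged over \<open>p\<close>, stationarity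
  cancels the squares of \<open>h\<close>, and \<open>potential_drift_eq\<close> turns the mixed
  term into the fourfold sum.\<close>

lemma asymptotic_variance_eq: "asymptotic_variance P p w = (\<Sum>i\<in>UNIV. p $ i * cond_variance w i)"
proof -
  define \<mu> where "\<mu> = asymptotic_mean P p w"
  define h where "h = potential (drift w)"
  let ?E = "\<lambda>f. \<Sum>i\<in>UNIV. p $ i * (\<Sum>j\<in>UNIV. P $ i $ j * f i j)"
  have "(\<Sum>i\<in>UNIV. p $ i * cond_variance w i) = ?E (\<lambda>i j. (w i j - \<mu>)\<^sup>2)
      + 2 * ?E (\<lambda>i j. (w i j - \<mu>) * h j) + ?E (\<lambda>i j. (h j)\<^sup>2) - (\<Sum>i\<in>UNIV. p $ i * (h i)\<^sup>2)"
    unfolding cond_variance_eq \<mu>_def[symmetric] h_def[symmetric]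
    by (simp add: distrib_left right_diff_distrib sum.distrib sum_subtractf sum_distrib_left
        mult.left_commute[of _ 2])
  also have "?E (\<lambda>i j. (h j)\<^sup>2) = (\<Sum>i\<in>UNIV. p $ i * (h i)\<^sup>2)" by (rule stationary_average)
  also have "?E (\<lambda>i j. (w i j - \<mu>)\<^sup>2) = ?E (\<lambda>i j. (w i j)\<^sup>2) - \<mu>\<^sup>2"
  proof -
    have "(\<Sum>j\<in>UNIV. P $ i $ j * (w i j - \<mu>)\<^sup>2) =
      (\<Sum>j\<in>UNIV. P $ i $ j * (w i j)\<^sup>2) - 2 * \<mu> * (\<Sum>j\<in>UNIV. P $ i $ j * w i j)
      + (\<Sum>j\<in>UNIV. P $ i $ j) * \<mu>\<^sup>2" for i
      unfolding sum_distrib_left sum_distrib_right sum.distrib[symmetric] sum_subtractf[symmetric]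
      by (intro sum.cong) (auto simp: power2_eq_square algebra_simps)
    moreover have "(\<Sum>i\<in>UNIV. p $ i * (a i - 2 * \<mu> * b i + \<mu>\<^sup>2)) =
      (\<Sum>i\<in>UNIV. p $ i * a i) - 2 * \<mu> * (\<Sum>i\<in>UNIV. p $ i * b i) + \<mu>\<^sup>2" for a b :: "'s \<Rightarrow> real"
    proof -
      have "(\<Sum>i\<in>UNIV. p $ i * (a i - 2 * \<mu> * b i + \<mu>\<^sup>2)) =
        (\<Sum>i\<in>UNIV. p $ i * a i) - 2 * \<mu> * (\<Sum>i\<in>UNIV. p $ i * b i) + (\<Sum>i\<in>UNIV. p $ i) * \<mu>\<^sup>2"
        unfolding sum_distrib_left sum_distrib_right sum.distrib[symmetric] sum_subtractf[symmetric]
        by (intro sum.cong) (auto simp: algebra_simps)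
      then show ?thesis by (simp add: p_sum)
    qed
    ultimately have "?E (\<lambda>i j. (w i j - \<mu>)\<^sup>2) = ?E (\<lambda>i j. (w i j)\<^sup>2) - 2 * \<mu> * ?E w + \<mu>\<^sup>2"
      by (simp only: P_row mult_1_left)
    then show ?thesis by (simp add: \<mu>_def asymptotic_mean_eq[symmetric] power2_eq_square)
  qed
  also have "?E (\<lambda>i j. (w i j - \<mu>) * h j) = ?E (\<lambda>i j. w i j * h j)"
  proof -
    have "?E (\<lambda>i j. (w i j - \<mu>) * h j) = ?E (\<lambda>i j. w i j * h j) - \<mu> * ?E (\<lambda>i j. h j)"
      unfolding sum_distrib_left sum_subtractf[symmetric]
      by (intro sum.cong) (auto simp: algebra_simps)
    then show ?thesis
      using p_potential[of "drift w"] by (simp add: stationary_average h_def p_drift)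
  qed
  also have "?E (\<lambda>i j. w i j * h j) = (\<Sum>i\<in>UNIV. \<Sum>j\<in>UNIV. \<Sum>k\<in>UNIV. \<Sum>l\<in>UNIV.
      p $ i * P $ i $ j * w i j * (Z j k - p $ k) * P $ k $ l * w k l)"
    unfolding h_def potential_drift_eq sum_distrib_left by (simp only: mult.assoc)
  finally show ?thesis
    by (simp add: asymptotic_variance_def \<mu>_def asymptotic_mean_def sum_distrib_left mult.assoc)
qed

lemma partial_sum_decompose:
  "partial_sum X w n \<omega> = partial_sum X (martingale_part w) n \<omega> + real n * asymptotic_mean P p w
    + (potential (drift w) (X 0 \<omega>) - potential (drift w) (X n \<omega>))"
  by (induction n) (auto simp: partial_sum_0 partial_sum_Suc martingale_part_def algebra_simps)

end

subsection \<open>Markov chains and their histories\<close>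

locale finite_markov_chain = prob_space M
  for M :: "'a measure" +
  fixes P :: "real ^ 's::finite ^ 's" and X :: "nat \<Rightarrow> 'a \<Rightarrow> 's"
  assumes chain: "markov_chain M P X"
begin

lemma X_measurable [measurable]: "X n \<in> measurable M (count_space UNIV)"
  using chain by (simp add: markov_chain_def)

lemma transition_nonneg: "0 \<le> P $ i $ j" and transition_row: "(\<Sum>j\<in>UNIV. P $ i $ j) = 1"
  using chain by (auto simp: markov_chain_def transition_matrix_def)

text \<open>Measurability with respect to \<open>X 0, \<dots>, X n\<close>; since the state space is finite, no
  \<open>\<sigma>\<close>-algebra is needed.\<close>

definition past :: "nat \<Rightarrow> ('a \<Rightarrow> 'b) \<Rightarrow> bool" where
  "past n Y \<longleftrightarrow> (\<forall>\<omega> \<omega>'. (\<forall>m\<le>n. X m \<omega> = X m \<omega>') \<longrightarrow> Y \<omega> = Y \<omega>')"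

lemma past_mono: "past m Y \<Longrightarrow> m \<le> n \<Longrightarrow> past n Y"
  unfolding past_def by (meson order_trans)

lemma past_const: "past n (\<lambda>_. a)"
  by (simp add: past_def)

lemma past_X: "m \<le> n \<Longrightarrow> past n (X m)"
  by (simp add: past_def)

lemma past_comp: "past n Y \<Longrightarrow> past n (\<lambda>\<omega>. f (Y \<omega>))"
  unfolding past_def by metis

lemma past_comp2: "past n Y \<Longrightarrow> past n Z \<Longrightarrow> past n (\<lambda>\<omega>. f (Y \<omega>) (Z \<omega>))"
  unfolding past_def by metis

lemma past_X_comp: "m \<le> n \<Longrightarrow> past n (\<lambda>\<omega>. f (X m \<omega>))"
  by (rule past_comp[OF past_X])

lemma past_partial_sum: "m \<le> n \<Longrightarrow> past n (partial_sum X w m)"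
  unfolding past_def partial_sum_def
proof (intro allI impI sum.cong refl)
  fix \<omega> \<omega>' k
  assume mn: "m \<le> n" and eq: "\<forall>k\<le>n. X k \<omega> = X k \<omega>'" and k: "k \<in> {1..m}"
  have "X (k - 1) \<omega> = X (k - 1) \<omega>'" using mn k by (intro eq[rule_format]) auto
  moreover have "X k \<omega> = X k \<omega>'" using mn k by (intro eq[rule_format]) auto
  ultimately show "w (X (k - 1) \<omega>) (X k \<omega>) = w (X (k - 1) \<omega>') (X k \<omega>')" by simp
qed

lemmas past_arith = past_const past_comp2[of _ _ _ "(+)"] past_comp2[of _ _ _ "(-)"]
  past_comp2[of _ _ _ "(*)"] past_comp[of _ _ "\<lambda>x. x ^ _"]

section \<open>Cylinder sets and the one-step formula\<close>

definition hist :: "nat \<Rightarrow> (nat \<Rightarrow> 's) \<Rightarrow> 'a set" where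
  "hist n x = {\<omega> \<in> space M. \<forall>m\<le>n. X m \<omega> = x m}"

lemma hist_sets [measurable]: "hist n x \<in> sets M"
  unfolding hist_def by measurable

text \<open>Extensionality of \<open>PiE\<close> makes this set finite and puts every outcome into
  exactly one cylinder \<open>hist n x\<close>; functions differing only beyond \<open>n\<close>
  would give the same cylinder.\<close>

definition histories :: "nat \<Rightarrow> (nat \<Rightarrow> 's) set" where
  "histories n = PiE {..n} (\<lambda>_. UNIV)"

lemma finite_histories: "finite (histories n)"
  unfolding histories_def by (rule finite_PiE) auto

lemma past_expand:
  fixes Y :: "'a \<Rightarrow> 'b::real_vector"
  assumes "past n Y"
  obtains y where
    "\<And>\<omega>. \<omega> \<in> space M \<Longrightarrow> Y \<omega> = (\<Sum>x\<in>histories n. indicat_real (hist n x) \<omega> *\<^sub>R y x)"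
proof
  fix \<omega> assume \<omega>: "\<omega> \<in> space M"
  \<comment> \<open>\<open>Y\<close> is constant on each cylinder, so any point of it serves. For an
    empty cylinder the value is arbitrary, but it is multiplied by a vanishing indicator.\<close>
  let ?y = "\<lambda>x. Y (SOME \<omega>. \<omega> \<in> hist n x)"
  define x0 where "x0 = restrict (\<lambda>m. X m \<omega>) {..n}"
  have x0: "x0 \<in> histories n" "\<omega> \<in> hist n x0"
    using \<omega> by (auto simp: x0_def histories_def hist_def)
  have iff: "\<omega> \<in> hist n x \<longleftrightarrow> x = x0" if "x \<in> histories n" for x
  proof
    assume "\<omega> \<in> hist n x"
    with that show "x = x0"
      by (auto simp: x0_def hist_def histories_def fun_eq_iff PiE_def extensional_def)
  qed (use x0 in simp)
  have "(\<Sum>x\<in>histories n. indicat_real (hist n x) \<omega> *\<^sub>R ?y x) =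
      (\<Sum>x\<in>histories n. if x = x0 then ?y x else 0)"
    by (intro sum.cong) (auto simp: iff)
  also have "\<dots> = ?y x0" using finite_histories x0 by simp
  also have "(SOME \<omega>. \<omega> \<in> hist n x0) \<in> hist n x0" using x0 by (auto intro: someI)
  then have "\<forall>m\<le>n. X m (SOME \<omega>. \<omega> \<in> hist n x0) = X m \<omega>"
    using x0 by (simp add: hist_def)
  then have "?y x0 = Y \<omega>" using assms unfolding past_def by blast
  finally show "Y \<omega> = (\<Sum>x\<in>histories n. indicat_real (hist n x) \<omega> *\<^sub>R ?y x)" by simp
qed

lemma integrable_past:
  fixes Y :: "'a \<Rightarrow> 'b::{banach, second_countable_topology}"
  assumes "past n Y"
  shows "integrable M Y"
proof -
  obtain y where y: "\<And>\<omega>. \<omega> \<in> space M \<Longrightarrow>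
      Y \<omega> = (\<Sum>x\<in>histories n. indicat_real (hist n x) \<omega> *\<^sub>R y x)"
    using past_expand[OF assms] by blast
  have "integrable M (\<lambda>\<omega>. \<Sum>x\<in>histories n. indicat_real (hist n x) \<omega> *\<^sub>R y x)"
    by (intro Bochner_Integration.integrable_sum integrable_scaleR_left
        integrable_real_indicator hist_sets) (simp add: emeasure_eq_measure)
  then show ?thesis using y by (subst Bochner_Integration.integrable_cong) auto
qed

text \<open>In product form the Markov property extends to null histories, about which
  \<open>markov_chain\<close> says nothing: both sides vanish.\<close>

lemma prob_hist_Suc:
  "prob (hist n x \<inter> {\<omega> \<in> space M. X (Suc n) \<omega> = j}) = prob (hist n x) * P $ x n $ j"
proof (cases "prob (hist n x) = 0")
  case True
  have "prob (hist n x \<inter> {\<omega> \<in> space M. X (Suc n) \<omega> = j}) \<le> prob (hist n x)"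
    by (intro finite_measure_mono) auto
  with True show ?thesis by (simp add: measure_le_0_iff)
next
  case False
  then have pos: "0 < prob (hist n x)" by (simp add: zero_less_measure_iff)
  then have "\<P>(\<omega> in M. X (Suc n) \<omega> = j \<bar> \<forall>m\<le>n. X m \<omega> = x m) = P $ x n $ j"
    using chain unfolding markov_chain_def hist_def by blast
  moreover have "hist n x \<inter> {\<omega> \<in> space M. X (Suc n) \<omega> = j} =
      {\<omega> \<in> space M. X (Suc n) \<omega> = j \<and> (\<forall>m\<le>n. X m \<omega> = x m)}"
    by (auto simp: hist_def)
  ultimately show ?thesis using pos by (simp add: cond_prob_def hist_def field_simps)
qed

lemma one_step_indicator:
  fixes Y :: "'a \<Rightarrow> 'b::{banach, second_countable_topology}"
  assumes "past n Y"
  shows "(\<integral>\<omega>. indicat_real {\<omega> \<in> space M. X (Suc n) \<omega> = j} \<omega> *\<^sub>R Y \<omega> \<partial>M) =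
    (\<integral>\<omega>. P $ X n \<omega> $ j *\<^sub>R Y \<omega> \<partial>M)"
proof -
  let ?A = "{\<omega> \<in> space M. X (Suc n) \<omega> = j}"
  obtain y where y: "\<And>\<omega>. \<omega> \<in> space M \<Longrightarrow>
      Y \<omega> = (\<Sum>x\<in>histories n. indicat_real (hist n x) \<omega> *\<^sub>R y x)"
    using past_expand[OF assms] by blast
  have "(\<integral>\<omega>. indicat_real ?A \<omega> *\<^sub>R Y \<omega> \<partial>M) =
      (\<integral>\<omega>. (\<Sum>x\<in>histories n. indicat_real (hist n x \<inter> ?A) \<omega> *\<^sub>R y x) \<partial>M)"
    by (intro Bochner_Integration.integral_cong)
      (auto simp: y scaleR_sum_right indicator_def intro!: sum.cong)
  also have "\<dots> = (\<Sum>x\<in>histories n. (prob (hist n x) * P $ x n $ j) *\<^sub>R y x)"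
    by (subst Bochner_Integration.integral_sum)
      (auto simp: prob_hist_Suc emeasure_eq_measure
        intro!: integrable_scaleR_left integrable_real_indicator sum.cong)
  also have "\<dots> = (\<integral>\<omega>. (\<Sum>x\<in>histories n. indicat_real (hist n x) \<omega> *\<^sub>R (P $ x n $ j *\<^sub>R y x)) \<partial>M)"
    by (subst Bochner_Integration.integral_sum)
      (auto simp: emeasure_eq_measure
        intro!: integrable_scaleR_left integrable_real_indicator sum.cong)
  also have "\<dots> = (\<integral>\<omega>. P $ X n \<omega> $ j *\<^sub>R Y \<omega> \<partial>M)"
    by (intro Bochner_Integration.integral_cong)
      (auto simp: y scaleR_sum_right indicator_def hist_def intro!: sum.cong)
  finally show ?thesis .
qed

text \<open>This replaces conditioning on \<open>X 0, ..., X n\<close>: the next state is averaged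
  out while the past stays in place. Values in a Banach space cover the complex integrands of the
  characteristic functions.\<close>

lemma one_step:
  fixes F :: "'a \<Rightarrow> 's \<Rightarrow> 'b::{banach, second_countable_topology}"
  assumes past: "\<And>j. past n (\<lambda>\<omega>. F \<omega> j)"
  shows "(\<integral>\<omega>. F \<omega> (X (Suc n) \<omega>) \<partial>M) = (\<integral>\<omega>. (\<Sum>j\<in>UNIV. P $ X n \<omega> $ j *\<^sub>R F \<omega> j) \<partial>M)"
proof -
  let ?A = "\<lambda>j. {\<omega> \<in> space M. X (Suc n) \<omega> = j}"
  have "(\<integral>\<omega>. F \<omega> (X (Suc n) \<omega>) \<partial>M) = (\<integral>\<omega>. (\<Sum>j\<in>UNIV. indicat_real (?A j) \<omega> *\<^sub>R F \<omega> j) \<partial>M)"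
  proof (intro Bochner_Integration.integral_cong refl)
    fix \<omega> assume "\<omega> \<in> space M"
    then have "(\<Sum>j\<in>UNIV. indicat_real (?A j) \<omega> *\<^sub>R F \<omega> j) =
        (\<Sum>j\<in>UNIV. if j = X (Suc n) \<omega> then F \<omega> j else 0)"
      by (intro sum.cong) auto
    then show "F \<omega> (X (Suc n) \<omega>) = (\<Sum>j\<in>UNIV. indicat_real (?A j) \<omega> *\<^sub>R F \<omega> j)" by simp
  qed
  also have "\<dots> = (\<Sum>j\<in>UNIV. \<integral>\<omega>. indicat_real (?A j) \<omega> *\<^sub>R F \<omega> j \<partial>M)"
  proof (intro Bochner_Integration.integral_sum)
    fix j
    have "past (Suc n) (\<lambda>\<omega>. of_bool (X (Suc n) \<omega> = j) *\<^sub>R F \<omega> j :: 'b)"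
      by (intro past_comp2[of _ _ _ scaleR] past_X_comp[of _ _ "\<lambda>i. of_bool (i = _)"]
          past_mono[OF past]) auto
    from integrable_past[OF this] show "integrable M (\<lambda>\<omega>. indicat_real (?A j) \<omega> *\<^sub>R F \<omega> j)"
      by (subst Bochner_Integration.integrable_cong) (auto simp: indicator_def)
  qed
  also have "\<dots> = (\<Sum>j\<in>UNIV. \<integral>\<omega>. P $ X n \<omega> $ j *\<^sub>R F \<omega> j \<partial>M)"
    by (intro sum.cong one_step_indicator past refl)
  also have "\<dots> = (\<integral>\<omega>. (\<Sum>j\<in>UNIV. P $ X n \<omega> $ j *\<^sub>R F \<omega> j) \<partial>M)"
    by (intro Bochner_Integration.integral_sum[symmetric] integrable_past[of n]
        past_comp2[of _ _ _ scaleR] past_X_comp[of _ _ "\<lambda>i. P $ i $ _"] past order_refl)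
  finally show ?thesis .
qed

end

subsection \<open>Moments of additive martingales\<close>

text \<open>The assumptions survive the negation of \<open>d\<close> with the same \<open>r\<close>,
  \<open>s\<close>, \<open>c\<close> and \<open>R\<close>, so one oscillation result yields both
  directions.\<close>

locale markov_martingale = finite_markov_chain M P X
  for M :: "'a measure" and P :: "real ^ 's::finite ^ 's" and X :: "nat \<Rightarrow> 'a \<Rightarrow> 's" +
  fixes d :: "'s \<Rightarrow> 's \<Rightarrow> real" and r :: "'s \<Rightarrow> real" and s c R :: real
  assumes centred: "(\<Sum>j\<in>UNIV. P $ i $ j * d i j) = 0"
    and r_poisson: "r i - (\<Sum>j\<in>UNIV. P $ i $ j * r j) = (\<Sum>j\<in>UNIV. P $ i $ j * (d i j)\<^sup>2) - s"
    and d_bound: "\<bar>d i j\<bar> \<le> c"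
    and r_bound: "\<bar>r i\<bar> \<le> R"
begin

abbreviation W :: "nat \<Rightarrow> 'a \<Rightarrow> real" where "W \<equiv> partial_sum X d"

lemma c_nonneg: "0 \<le> c"
  using d_bound abs_ge_zero order_trans by blast

lemma d_square_le: "(d i j)\<^sup>2 \<le> c\<^sup>2"
  using power_mono[OF d_bound abs_ge_zero, of _ _ 2] by simp

definition incr :: "nat \<Rightarrow> nat \<Rightarrow> 'a \<Rightarrow> real" where
  "incr m k \<omega> = W (m + k) \<omega> - W m \<omega>"

lemma incr_0: "incr m 0 \<omega> = 0"
  and incr_Suc: "incr m (Suc k) \<omega> = incr m k \<omega> + d (X (m + k) \<omega>) (X (Suc (m + k)) \<omega>)"
  by (simp_all add: incr_def partial_sum_Suc)

lemma past_incr: "m + k \<le> n \<Longrightarrow> past n (incr m k)"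
  unfolding incr_def[abs_def] by (intro past_arith past_partial_sum) auto

lemma past_d: "m \<le> n \<Longrightarrow> k \<le> n \<Longrightarrow> past n (\<lambda>\<omega>. d (X m \<omega>) (X k \<omega>))"
  by (rule past_comp2[OF past_X past_X])

lemma past_d_left: "m \<le> n \<Longrightarrow> past n (\<lambda>\<omega>. d (X m \<omega>) j)"
  by (rule past_X_comp)

lemma past_r: "m \<le> n \<Longrightarrow> past n (\<lambda>\<omega>. r (X m \<omega>))"
  by (rule past_X_comp)

lemmas past_intros = past_arith past_incr past_d past_r past_partial_sum

text \<open>The square of \<open>d\<close> shares the coefficient \<open>e\<close> with
  \<open>r\<close> because it is their sum whose one-step mean is known, namely
  \<open>s + r i\<close>.\<close>

lemma P_poly:
  "(\<Sum>j\<in>UNIV. P $ i $ j * (a + b * d i j + e * ((d i j)\<^sup>2 + r j))) = a + e * (s + r i)"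
proof -
  have "(\<Sum>j\<in>UNIV. P $ i $ j * (a + b * d i j + e * ((d i j)\<^sup>2 + r j))) =
     (\<Sum>j\<in>UNIV. P $ i $ j) * a + b * (\<Sum>j\<in>UNIV. P $ i $ j * d i j)
     + e * ((\<Sum>j\<in>UNIV. P $ i $ j * (d i j)\<^sup>2) + (\<Sum>j\<in>UNIV. P $ i $ j * r j))"
    unfolding sum_distrib_left sum_distrib_right sum.distrib[symmetric]
    by (intro sum.cong) (auto simp: algebra_simps)
  then show ?thesis using r_poisson[of i] by (simp add: transition_row centred)
qed

lemma orthogonal:
  assumes "past n G"
  shows "(\<integral>\<omega>. G \<omega> * d (X n \<omega>) (X (Suc n) \<omega>) \<partial>M) = 0"
proof -
  have "(\<integral>\<omega>. G \<omega> * d (X n \<omega>) (X (Suc n) \<omega>) \<partial>M) =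
      (\<integral>\<omega>. (\<Sum>j\<in>UNIV. P $ X n \<omega> $ j *\<^sub>R (G \<omega> * d (X n \<omega>) j)) \<partial>M)"
    by (rule one_step) (intro past_intros past_d_left assms order_refl)
  also have "\<dots> = (\<integral>\<omega>. 0 \<partial>M)"
    using P_poly[of _ 0 _ 0] by (intro Bochner_Integration.integral_cong) auto
  finally show ?thesis by simp
qed

text \<open>Here and in the following moment lemmas the weight \<open>Y\<close>, known at time
  \<open>m\<close>, encodes conditioning on the past of \<open>m\<close>; the weight 1 gives the
  plain moments.\<close>

lemma incr_mean:
  assumes Y: "past m Y"
  shows "(\<integral>\<omega>. Y \<omega> * incr m k \<omega> \<partial>M) = 0"
proof (induction k)
  case (Suc k)
  have Y': "past (m + k) Y" "past (Suc (m + k)) Y" using past_mono[OF Y] by auto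
  have "(\<integral>\<omega>. Y \<omega> * incr m (Suc k) \<omega> \<partial>M) =
     (\<integral>\<omega>. Y \<omega> * incr m k \<omega> \<partial>M) + (\<integral>\<omega>. Y \<omega> * d (X (m + k) \<omega>) (X (Suc (m + k)) \<omega>) \<partial>M)"
    unfolding incr_Suc distrib_left
    by (intro Bochner_Integration.integral_add integrable_past[of "Suc (m + k)"] past_intros Y') auto
  then show ?case by (simp add: Suc orthogonal Y')
qed (simp add: incr_0)

lemma incr_square:
  assumes Y: "past m Y"
  shows "(\<integral>\<omega>. Y \<omega> * (incr m k \<omega>)\<^sup>2 \<partial>M) =
    real k * s * (\<integral>\<omega>. Y \<omega> \<partial>M) + (\<integral>\<omega>. Y \<omega> * (r (X m \<omega>) - r (X (m + k) \<omega>)) \<partial>M)"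
proof -
  have Y': "past (m + k) Y" for k using past_mono[OF Y] by auto
  have main: "(\<integral>\<omega>. Y \<omega> * ((incr m k \<omega>)\<^sup>2 + r (X (m + k) \<omega>) - real k * s) \<partial>M) =
      (\<integral>\<omega>. Y \<omega> * r (X m \<omega>) \<partial>M)"
  proof (induction k)
    case (Suc k)
    have "(\<integral>\<omega>. Y \<omega> * ((incr m (Suc k) \<omega>)\<^sup>2 + r (X (m + Suc k) \<omega>) - real (Suc k) * s) \<partial>M) =
      (\<integral>\<omega>. Y \<omega> * ((incr m k \<omega> + d (X (m + k) \<omega>) (X (Suc (m + k)) \<omega>))\<^sup>2
         + r (X (Suc (m + k)) \<omega>) - real (Suc k) * s) \<partial>M)"
      by (simp add: incr_Suc)
    also have "\<dots> = (\<integral>\<omega>. (\<Sum>j\<in>UNIV. P $ X (m + k) \<omega> $ j *\<^sub>R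
        (Y \<omega> * ((incr m k \<omega> + d (X (m + k) \<omega>) j)\<^sup>2 + r j - real (Suc k) * s))) \<partial>M)"
      by (rule one_step)
        (intro past_intros past_d_left Y' order_refl)
    also have "\<dots> = (\<integral>\<omega>. Y \<omega> * ((incr m k \<omega>)\<^sup>2 + r (X (m + k) \<omega>) - real k * s) \<partial>M)"
    proof (intro Bochner_Integration.integral_cong refl)
      fix \<omega>
      let ?T = "incr m k \<omega>" and ?i = "X (m + k) \<omega>"
      have "(\<Sum>j\<in>UNIV. P $ ?i $ j *\<^sub>R (Y \<omega> * ((?T + d ?i j)\<^sup>2 + r j - real (Suc k) * s))) =
        (\<Sum>j\<in>UNIV. P $ ?i $ j * (Y \<omega> * (?T\<^sup>2 - real (Suc k) * s) + (2 * Y \<omega> * ?T) * d ?i j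
          + Y \<omega> * ((d ?i j)\<^sup>2 + r j)))"
        by (intro sum.cong) (auto simp: algebra_simps power2_eq_square)
      also have "\<dots> = Y \<omega> * (?T\<^sup>2 + r ?i - real k * s)"
        unfolding P_poly by (simp add: algebra_simps)
      finally show "(\<Sum>j\<in>UNIV. P $ ?i $ j *\<^sub>R (Y \<omega> * ((?T + d ?i j)\<^sup>2 + r j - real (Suc k) * s)))
        = Y \<omega> * (?T\<^sup>2 + r ?i - real k * s)" .
    qed
    finally show ?case using Suc by simp
  qed (simp add: incr_0)
  have "(\<integral>\<omega>. Y \<omega> * (incr m k \<omega>)\<^sup>2 \<partial>M) =
     (\<integral>\<omega>. (Y \<omega> * ((incr m k \<omega>)\<^sup>2 + r (X (m + k) \<omega>) - real k * s) + real k * s * Y \<omega>)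
        - Y \<omega> * r (X (m + k) \<omega>) \<partial>M)"
    by (intro Bochner_Integration.integral_cong) (auto simp: algebra_simps)
  also have "\<dots> = (\<integral>\<omega>. Y \<omega> * r (X m \<omega>) \<partial>M) + real k * s * (\<integral>\<omega>. Y \<omega> \<partial>M)
      - (\<integral>\<omega>. Y \<omega> * r (X (m + k) \<omega>) \<partial>M)"
    by (subst Bochner_Integration.integral_diff Bochner_Integration.integral_add,
        (intro integrable_past[of "m + k"] past_intros Y'; simp)+)+ (simp add: main)
  also have "\<dots> = real k * s * (\<integral>\<omega>. Y \<omega> \<partial>M) + (\<integral>\<omega>. Y \<omega> * (r (X m \<omega>) - r (X (m + k) \<omega>)) \<partial>M)"
    unfolding right_diff_distrib
    by (subst Bochner_Integration.integral_diff,
        (intro integrable_past[of "m + k"] past_intros Y'; simp)+) simp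
  finally show ?thesis .
qed

text \<open>Cruder than \<open>incr_square\<close> but without boundary term: the bound is
  proportional to \<open>k\<close> from the start, which suits the induction for the fourth
  moment.\<close>

lemma incr_square_le:
  assumes Y: "past m Y" and nonneg: "\<And>\<omega>. 0 \<le> Y \<omega>"
  shows "(\<integral>\<omega>. Y \<omega> * (incr m k \<omega>)\<^sup>2 \<partial>M) \<le> real k * c\<^sup>2 * (\<integral>\<omega>. Y \<omega> \<partial>M)"
proof (induction k)
  case (Suc k)
  have Y': "past (m + k) Y" "past (Suc (m + k)) Y" using past_mono[OF Y] by auto
  let ?d = "\<lambda>\<omega>. d (X (m + k) \<omega>) (X (Suc (m + k)) \<omega>)"
  have "(\<integral>\<omega>. Y \<omega> * (incr m (Suc k) \<omega>)\<^sup>2 \<partial>M) \<le>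
     (\<integral>\<omega>. Y \<omega> * (incr m k \<omega>)\<^sup>2 + (2 * Y \<omega> * incr m k \<omega>) * ?d \<omega> + c\<^sup>2 * Y \<omega> \<partial>M)"
  proof (intro integral_mono integrable_past[of "Suc (m + k)"])
    fix \<omega>
    have "Y \<omega> * (?d \<omega>)\<^sup>2 \<le> Y \<omega> * c\<^sup>2" using d_square_le nonneg by (intro mult_left_mono)
    then show "Y \<omega> * (incr m (Suc k) \<omega>)\<^sup>2 \<le>
      Y \<omega> * (incr m k \<omega>)\<^sup>2 + (2 * Y \<omega> * incr m k \<omega>) * ?d \<omega> + c\<^sup>2 * Y \<omega>"
      by (simp add: incr_Suc power2_sum algebra_simps)
  qed (intro past_intros Y'; simp)+
  also have "\<dots> = (\<integral>\<omega>. Y \<omega> * (incr m k \<omega>)\<^sup>2 \<partial>M)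
      + (\<integral>\<omega>. (2 * Y \<omega> * incr m k \<omega>) * ?d \<omega> \<partial>M) + (\<integral>\<omega>. c\<^sup>2 * Y \<omega> \<partial>M)"
    by (subst Bochner_Integration.integral_add,
        (intro integrable_past[of "Suc (m + k)"] past_intros Y'; simp)+)+ simp
  also have "(\<integral>\<omega>. (2 * Y \<omega> * incr m k \<omega>) * ?d \<omega> \<partial>M) = 0"
    by (intro orthogonal past_intros Y') simp
  finally show ?case using Suc by (simp add: algebra_simps)
qed (simp add: incr_0)

text \<open>In the fourth power of old increment plus new step, the term linear in the step
  integrates to zero. The others cost order \<open>k\<close> per step, which sums to the square of
  \<open>k\<close>.\<close>

lemma incr_fourth_le:
  assumes Y: "past m Y" and nonneg: "\<And>\<omega>. 0 \<le> Y \<omega>"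
  shows "(\<integral>\<omega>. Y \<omega> * (incr m k \<omega>) ^ 4 \<partial>M) \<le> 7 * c ^ 4 * (real k)\<^sup>2 * (\<integral>\<omega>. Y \<omega> \<partial>M)"
proof (induction k)
  case (Suc k)
  have Y': "past (m + k) Y" "past (Suc (m + k)) Y" using past_mono[OF Y] by auto
  let ?d = "\<lambda>\<omega>. d (X (m + k) \<omega>) (X (Suc (m + k)) \<omega>)"
  let ?EY = "\<integral>\<omega>. Y \<omega> \<partial>M"
  have EY: "0 \<le> ?EY" by (intro Bochner_Integration.integral_nonneg nonneg)
  have "(\<integral>\<omega>. Y \<omega> * (incr m (Suc k) \<omega>) ^ 4 \<partial>M) \<le>
     (\<integral>\<omega>. Y \<omega> * (incr m k \<omega>) ^ 4 + (4 * Y \<omega> * incr m k \<omega> ^ 3) * ?d \<omega>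
        + (8 * c\<^sup>2) * (Y \<omega> * (incr m k \<omega>)\<^sup>2) + (3 * c ^ 4) * Y \<omega> \<partial>M)"
  proof (intro integral_mono integrable_past[of "Suc (m + k)"])
    fix \<omega>
    let ?T = "incr m k \<omega>" and ?D = "?d \<omega>"
    have D2: "?D\<^sup>2 \<le> c\<^sup>2" by (rule d_square_le)
    have D4: "?D ^ 4 \<le> c ^ 4"
      using power_mono[OF D2, of 2] by simp
    have "(?T + ?D) ^ 4 = ?T ^ 4 + 4 * ?T ^ 3 * ?D + 6 * (?T\<^sup>2 * ?D\<^sup>2) + 4 * ?T * ?D ^ 3 + ?D ^ 4"
      by (simp add: algebra_simps power2_eq_square power3_eq_cube power4_eq_xxxx)
    \<comment> \<open>Twice the square of \<open>?T * ?D - ?D\<^sup>2\<close> is nonnegative. The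
      coefficients 6 and 1 of the even terms thereby become 8 and 3.\<close>
    also have "4 * ?T * ?D ^ 3 \<le> 2 * (?T\<^sup>2 * ?D\<^sup>2) + 2 * ?D ^ 4"
      using zero_le_power2[of "?T * ?D - ?D\<^sup>2"]
      by (simp add: algebra_simps power2_eq_square power3_eq_cube power4_eq_xxxx)
    finally have "(?T + ?D) ^ 4 \<le> ?T ^ 4 + 4 * ?T ^ 3 * ?D + 8 * (?T\<^sup>2 * ?D\<^sup>2) + 3 * ?D ^ 4"
      by simp
    also have "\<dots> \<le> ?T ^ 4 + 4 * ?T ^ 3 * ?D + 8 * (?T\<^sup>2 * c\<^sup>2) + 3 * c ^ 4"
      using mult_left_mono[OF D2, of "?T\<^sup>2"] D4 by simp
    finally have "Y \<omega> * (?T + ?D) ^ 4 \<le> Y \<omega> * (?T ^ 4 + 4 * ?T ^ 3 * ?D + 8 * (?T\<^sup>2 * c\<^sup>2) + 3 * c ^ 4)"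
      using nonneg by (intro mult_left_mono)
    then show "Y \<omega> * (incr m (Suc k) \<omega>) ^ 4 \<le> Y \<omega> * ?T ^ 4 + (4 * Y \<omega> * ?T ^ 3) * ?D
        + (8 * c\<^sup>2) * (Y \<omega> * ?T\<^sup>2) + (3 * c ^ 4) * Y \<omega>"
      by (simp add: incr_Suc algebra_simps)
  qed (intro past_intros Y'; simp)+
  also have "\<dots> = (\<integral>\<omega>. Y \<omega> * (incr m k \<omega>) ^ 4 \<partial>M)
      + (\<integral>\<omega>. (4 * Y \<omega> * incr m k \<omega> ^ 3) * ?d \<omega> \<partial>M)
      + (8 * c\<^sup>2) * (\<integral>\<omega>. Y \<omega> * (incr m k \<omega>)\<^sup>2 \<partial>M) + 3 * c ^ 4 * ?EY"
    by (subst Bochner_Integration.integral_add,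
        (intro integrable_past[of "Suc (m + k)"] past_intros Y'; simp)+)+ simp
  also have "(\<integral>\<omega>. (4 * Y \<omega> * incr m k \<omega> ^ 3) * ?d \<omega> \<partial>M) = 0"
    by (intro orthogonal past_intros Y') simp
  also have "(\<integral>\<omega>. Y \<omega> * (incr m k \<omega>) ^ 4 \<partial>M) + 0
      + (8 * c\<^sup>2) * (\<integral>\<omega>. Y \<omega> * (incr m k \<omega>)\<^sup>2 \<partial>M) + 3 * c ^ 4 * ?EY
     \<le> 7 * c ^ 4 * (real k)\<^sup>2 * ?EY + (8 * c\<^sup>2) * (real k * c\<^sup>2 * ?EY) + 3 * c ^ 4 * ?EY"
    using Suc incr_square_le[OF Y nonneg, of k] by (intro add_mono mult_left_mono) auto
  also have "\<dots> = (7 * (real k)\<^sup>2 + 8 * real k + 3) * (c ^ 4 * ?EY)"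
    by (simp add: algebra_simps power2_eq_square power4_eq_xxxx)
  \<comment> \<open>Any constant \<open>C\<close> with
    \<open>8 * k + 3 \<le> C * (2 * k + 1)\<close> closes the induction; 7 is not sharp.\<close>
  also have "\<dots> \<le> (7 * (real (Suc k))\<^sup>2) * (c ^ 4 * ?EY)"
    using EY by (intro mult_right_mono) (auto simp: power2_eq_square algebra_simps)
  finally show ?case by (simp add: algebra_simps)
qed (simp add: incr_0)

section \<open>The strong law and the asymptotic variance\<close>

lemma W_eq_incr: "W n = incr 0 n"
  by (auto simp: incr_def partial_sum_0)

lemma W_mean: "(\<integral>\<omega>. W n \<omega> \<partial>M) = 0"
  using incr_mean[OF past_const[of 0 1], of n] by (simp add: W_eq_incr)

lemma W_square: "\<bar>(\<integral>\<omega>. (W n \<omega>)\<^sup>2 \<partial>M) - real n * s\<bar> \<le> 2 * R"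
proof -
  have "\<bar>\<integral>\<omega>. r (X 0 \<omega>) - r (X n \<omega>) \<partial>M\<bar> \<le> (\<integral>\<omega>. \<bar>r (X 0 \<omega>) - r (X n \<omega>)\<bar> \<partial>M)"
    using integral_norm_bound[of M "\<lambda>\<omega>. r (X 0 \<omega>) - r (X n \<omega>)"] by simp
  also have "\<dots> \<le> (\<integral>\<omega>. 2 * R \<partial>M)"
  proof (intro integral_mono integrable_past[of n] past_const past_comp[of _ _ abs] past_intros)
    show "\<bar>r (X 0 \<omega>) - r (X n \<omega>)\<bar> \<le> 2 * R" for \<omega>
      using r_bound[of "X 0 \<omega>"] r_bound[of "X n \<omega>"] by linarith
  qed auto
  finally show ?thesis
    using incr_square[OF past_const[of 0 1], of n] by (simp add: W_eq_incr prob_space)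
qed

lemma W_square_le: "(\<integral>\<omega>. (W n \<omega>)\<^sup>2 \<partial>M) \<le> real n * c\<^sup>2"
  using incr_square_le[OF past_const[of 0 1], of n] by (simp add: W_eq_incr prob_space)

lemma W_fourth_le: "(\<integral>\<omega>. W n \<omega> ^ 4 \<partial>M) \<le> 7 * c ^ 4 * (real n)\<^sup>2"
  using incr_fourth_le[OF past_const[of 0 1], of n] by (simp add: W_eq_incr prob_space)

text \<open>The mean of \<open>(W n / n) ^ 4\<close> has the summable order
  \<open>1 / n ^ 2\<close>, so the series of these powers is almost surely finite and its terms tend
  to 0. Second moments would give only the order \<open>1 / n\<close>.\<close>

lemma W_strong_law: "AE \<omega> in M. (\<lambda>n. W n \<omega> / real n) \<longlonglongrightarrow> 0"
proof -
  define f where "f n \<omega> = (W (Suc n) \<omega> / real (Suc n)) ^ 4" for n \<omega>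
  have past_f: "past (Suc n) (f n)" for n
    unfolding f_def by (intro past_comp[of _ _ "\<lambda>x. (x / _) ^ 4"] past_partial_sum) simp
  have f_nonneg: "0 \<le> f n \<omega>" for n \<omega> by (simp add: f_def)
  have Ef: "(\<integral>\<omega>. f n \<omega> \<partial>M) \<le> 7 * c ^ 4 * inverse ((real (Suc n))\<^sup>2)" for n
  proof -
    have "(\<integral>\<omega>. f n \<omega> \<partial>M) = (\<integral>\<omega>. W (Suc n) \<omega> ^ 4 \<partial>M) / real (Suc n) ^ 4"
      by (simp add: f_def power_divide)
    also have "\<dots> \<le> (7 * c ^ 4 * (real (Suc n))\<^sup>2) / real (Suc n) ^ 4"
      by (intro divide_right_mono W_fourth_le) simp
    also have "\<dots> = 7 * c ^ 4 * inverse ((real (Suc n))\<^sup>2)"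
      by (simp add: field_simps power2_eq_square power4_eq_xxxx del: of_nat_Suc)
    finally show ?thesis .
  qed
  have "summable (\<lambda>n. 7 * c ^ 4 * inverse ((real (Suc n))\<^sup>2))"
    using inverse_power_summable[of 2, where 'a = real]
    by (intro summable_mult) (subst summable_Suc_iff, simp)
  then have "(\<Sum>n. ennreal (7 * c ^ 4 * inverse ((real (Suc n))\<^sup>2))) \<noteq> \<infinity>"
    by (subst suminf_ennreal2) (auto simp: c_nonneg)
  moreover have "(\<integral>\<^sup>+\<omega>. (\<Sum>n. ennreal (f n \<omega>)) \<partial>M) \<le>
      (\<Sum>n. ennreal (7 * c ^ 4 * inverse ((real (Suc n))\<^sup>2)))"
  proof -
    have meas: "f n \<in> borel_measurable M" for n
      using integrable_past[OF past_f] by simp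
    have "(\<integral>\<^sup>+\<omega>. (\<Sum>n. ennreal (f n \<omega>)) \<partial>M) = (\<Sum>n. \<integral>\<^sup>+\<omega>. ennreal (f n \<omega>) \<partial>M)"
      using meas by (intro nn_integral_suminf) auto
    also have "\<dots> = (\<Sum>n. ennreal (\<integral>\<omega>. f n \<omega> \<partial>M))"
      by (intro suminf_cong nn_integral_eq_integral integrable_past[OF past_f]) (simp add: f_nonneg)
    also have "\<dots> \<le> (\<Sum>n. ennreal (7 * c ^ 4 * inverse ((real (Suc n))\<^sup>2)))"
      by (intro suminf_le ennreal_leI Ef) auto
    finally show ?thesis .
  qed
  ultimately have fin: "(\<integral>\<^sup>+\<omega>. (\<Sum>n. ennreal (f n \<omega>)) \<partial>M) \<noteq> \<infinity>"
    by (metis infinity_ennreal_def top.extremum_uniqueI)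
  have meas: "(\<lambda>\<omega>. \<Sum>n. ennreal (f n \<omega>)) \<in> borel_measurable M"
    using borel_measurable_integrable[OF integrable_past[OF past_f]] by measurable
  have "AE \<omega> in M. (\<Sum>n. ennreal (f n \<omega>)) \<noteq> \<infinity>"
    by (rule nn_integral_noteq_infinite[OF meas fin])
  then show ?thesis
  proof eventually_elim
    case (elim \<omega>)
    then have "summable (\<lambda>n. f n \<omega>)"
      by (intro summable_suminf_not_top) (auto simp: f_nonneg)
    then have "(\<lambda>n. f n \<omega>) \<longlonglongrightarrow> 0" by (rule summable_LIMSEQ_zero)
    then have "(\<lambda>n. root 4 (f n \<omega>)) \<longlonglongrightarrow> root 4 0" by (rule tendsto_real_root)
    moreover have "root 4 (f n \<omega>) = \<bar>W (Suc n) \<omega> / real (Suc n)\<bar>" for n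
    proof -
      have "f n \<omega> = \<bar>W (Suc n) \<omega> / real (Suc n)\<bar> ^ 4"
        unfolding f_def by (metis even_numeral power_even_abs)
      then show ?thesis by (simp only: real_root_power_cancel abs_ge_zero zero_less_numeral)
    qed
    ultimately have "(\<lambda>n. \<bar>W (Suc n) \<omega> / real (Suc n)\<bar>) \<longlonglongrightarrow> 0" by simp
    then have "(\<lambda>n. W (Suc n) \<omega> / real (Suc n)) \<longlonglongrightarrow> 0" by (rule tendsto_rabs_zero_cancel)
    then show ?case by (rule LIMSEQ_imp_Suc)
  qed
qed

lemma variance_limit:
  fixes h :: "'s \<Rightarrow> real"
  assumes h: "\<And>i. \<bar>h i\<bar> \<le> H"
  shows "(\<lambda>n. variance (\<lambda>\<omega>. W n \<omega> + real n * \<mu> + (h (X 0 \<omega>) - h (X n \<omega>))) / real n) \<longlonglongrightarrow> s"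
proof -
  let ?V = "\<lambda>n. variance (\<lambda>\<omega>. W n \<omega> + real n * \<mu> + (h (X 0 \<omega>) - h (X n \<omega>)))"
  \<comment> \<open>The boundary term and its mean are each bounded by \<open>2 * H\<close>;
    \<open>K\<close> bounds the centred boundary term.\<close>
  define K where "K = 4 * H"
  have K: "0 \<le> K" using h abs_ge_zero order_trans unfolding K_def by (metis mult_nonneg_nonneg zero_le_numeral)
  have bound: "\<bar>?V n - real n * s\<bar> \<le> 2 * R + K * (c\<^sup>2 + 1) * sqrt (real n) + K\<^sup>2" if n: "0 < n" for n
  proof -
    define B where "B \<omega> = h (X 0 \<omega>) - h (X n \<omega>)" for \<omega>
    define e where "e = (\<integral>\<omega>. B \<omega> \<partial>M)"
    define C where "C \<omega> = B \<omega> - e" for \<omega>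
    have past_W: "past n (W n)" by (rule past_partial_sum) simp
    have past_B: "past n B" unfolding B_def by (intro past_arith past_X_comp) auto
    have past_C: "past n C" unfolding C_def by (intro past_arith past_B)
    have B_le: "\<bar>B \<omega>\<bar> \<le> 2 * H" for \<omega>
      using h[of "X 0 \<omega>"] h[of "X n \<omega>"] by (simp add: B_def)
    have "\<bar>e\<bar> \<le> (\<integral>\<omega>. \<bar>B \<omega>\<bar> \<partial>M)"
      using integral_norm_bound[of M B] by (simp add: e_def)
    also have "\<dots> \<le> (\<integral>\<omega>. 2 * H \<partial>M)"
      by (intro integral_mono integrable_past[of n] past_const past_comp[of _ _ abs] past_B B_le)
    finally have "\<bar>e\<bar> \<le> 2 * H" by (simp add: prob_space)
    then have C_le: "\<bar>C \<omega>\<bar> \<le> K" for \<omega> using B_le[of \<omega>] by (simp add: C_def K_def)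
    have "(\<integral>\<omega>. W n \<omega> + real n * \<mu> + B \<omega> \<partial>M) = real n * \<mu> + e"
      by (simp add: W_mean e_def prob_space integrable_past[OF past_W] integrable_past[OF past_B])
    then have "?V n = (\<integral>\<omega>. (W n \<omega>)\<^sup>2 + (2 * W n \<omega> * C \<omega> + (C \<omega>)\<^sup>2) \<partial>M)"
      unfolding B_def[symmetric]
      by (intro Bochner_Integration.integral_cong) (auto simp: C_def power2_eq_square algebra_simps)
    also have "\<dots> = (\<integral>\<omega>. (W n \<omega>)\<^sup>2 \<partial>M) + (\<integral>\<omega>. 2 * W n \<omega> * C \<omega> + (C \<omega>)\<^sup>2 \<partial>M)"
      by (intro Bochner_Integration.integral_add integrable_past[of n] past_arith past_W past_C)
    finally have V: "?V n = (\<integral>\<omega>. (W n \<omega>)\<^sup>2 \<partial>M) + (\<integral>\<omega>. 2 * W n \<omega> * C \<omega> + (C \<omega>)\<^sup>2 \<partial>M)" .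
    have "\<bar>\<integral>\<omega>. 2 * W n \<omega> * C \<omega> + (C \<omega>)\<^sup>2 \<partial>M\<bar> \<le> (\<integral>\<omega>. \<bar>2 * W n \<omega> * C \<omega> + (C \<omega>)\<^sup>2\<bar> \<partial>M)"
      using integral_norm_bound[of M "\<lambda>\<omega>. 2 * W n \<omega> * C \<omega> + (C \<omega>)\<^sup>2"] by simp
    also have "\<dots> \<le> (\<integral>\<omega>. K / sqrt (real n) * (W n \<omega>)\<^sup>2 + (K * sqrt (real n) + K\<^sup>2) \<partial>M)"
    proof (intro integral_mono integrable_past[of n] past_comp[of _ _ abs] past_arith past_W past_C)
      fix \<omega>
      \<comment> \<open>The scale \<open>sqrt (real n)\<close> balances the two terms, since the
        mean of \<open>(W n \<omega>)\<^sup>2\<close> is of order \<open>n\<close>. The mixed term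
        of the variance is then of order \<open>sqrt (real n)\<close>.\<close>
      have "0 \<le> (\<bar>W n \<omega>\<bar> - sqrt (real n))\<^sup>2" by simp
      then have "2 * \<bar>W n \<omega>\<bar> * sqrt (real n) \<le> (W n \<omega>)\<^sup>2 + real n"
        by (simp add: power2_diff)
      then have "2 * \<bar>W n \<omega>\<bar> \<le> ((W n \<omega>)\<^sup>2 + real n) / sqrt (real n)"
        using n by (simp add: pos_le_divide_eq)
      also have "\<dots> = (W n \<omega>)\<^sup>2 / sqrt (real n) + sqrt (real n)"
        using n by (simp add: add_divide_distrib real_div_sqrt)
      finally have *: "2 * \<bar>W n \<omega>\<bar> \<le> (W n \<omega>)\<^sup>2 / sqrt (real n) + sqrt (real n)" .
      have "\<bar>2 * W n \<omega> * C \<omega>\<bar> \<le> ((W n \<omega>)\<^sup>2 / sqrt (real n) + sqrt (real n)) * K"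
        unfolding abs_mult using * C_le[of \<omega>] K by (intro mult_mono) auto
      moreover have "(C \<omega>)\<^sup>2 \<le> K\<^sup>2" using C_le[of \<omega>] K by (simp add: abs_le_square_iff[symmetric])
      ultimately have "\<bar>2 * W n \<omega> * C \<omega> + (C \<omega>)\<^sup>2\<bar>
          \<le> ((W n \<omega>)\<^sup>2 / sqrt (real n) + sqrt (real n)) * K + K\<^sup>2"
        by (smt (verit) zero_le_power2)
      then show "\<bar>2 * W n \<omega> * C \<omega> + (C \<omega>)\<^sup>2\<bar> \<le>
          K / sqrt (real n) * (W n \<omega>)\<^sup>2 + (K * sqrt (real n) + K\<^sup>2)"
        by (simp add: algebra_simps)
    qed
    also have "\<dots> = K / sqrt (real n) * (\<integral>\<omega>. (W n \<omega>)\<^sup>2 \<partial>M) + (K * sqrt (real n) + K\<^sup>2)"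
      using integrable_past[OF past_comp[OF past_W, of "\<lambda>x. x\<^sup>2"]]
      by (subst Bochner_Integration.integral_add) (auto simp: prob_space)
    also have "\<dots> \<le> K / sqrt (real n) * (real n * c\<^sup>2) + (K * sqrt (real n) + K\<^sup>2)"
      using K by (intro add_right_mono mult_left_mono W_square_le) auto
    also have "K / sqrt (real n) * (real n * c\<^sup>2) = K * c\<^sup>2 * (real n / sqrt (real n))" by simp
    also have "real n / sqrt (real n) = sqrt (real n)" by (simp add: real_div_sqrt)
    finally show ?thesis using W_square[of n] unfolding V by (simp add: algebra_simps)
  qed
  have "(\<lambda>n. ?V n / real n - s) \<longlonglongrightarrow> 0"
  proof (rule tendsto_rabs_zero_cancel, rule tendsto_sandwich[OF _ _ tendsto_const])
    show "\<forall>\<^sub>F n in sequentially. \<bar>?V n / real n - s\<bar> \<le>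
        2 * R / real n + K * (c\<^sup>2 + 1) * (sqrt (real n) / real n) + K\<^sup>2 / real n"
      using eventually_gt_at_top[of 0]
    proof eventually_elim
      case (elim n)
      then have "?V n / real n - s = (?V n - real n * s) / real n"
        by (simp add: diff_divide_distrib)
      then have "\<bar>?V n / real n - s\<bar> = \<bar>?V n - real n * s\<bar> / real n"
        by (simp only: abs_divide abs_of_nat)
      also have "\<dots> \<le> (2 * R + K * (c\<^sup>2 + 1) * sqrt (real n) + K\<^sup>2) / real n"
        by (intro divide_right_mono bound elim) simp
      finally show ?case by (simp add: add_divide_distrib)
    qed
    have "(\<lambda>n. sqrt (real n) / real n) \<longlonglongrightarrow> 0" by real_asymp
    moreover have "(\<lambda>n. 1 / real n) \<longlonglongrightarrow> 0" by real_asymp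
    ultimately have "(\<lambda>n. 2 * R * (1 / real n) + K * (c\<^sup>2 + 1) * (sqrt (real n) / real n)
        + K\<^sup>2 * (1 / real n)) \<longlonglongrightarrow> 2 * R * 0 + K * (c\<^sup>2 + 1) * 0 + K\<^sup>2 * 0"
      by (intro tendsto_intros)
    then show "(\<lambda>n. 2 * R / real n + K * (c\<^sup>2 + 1) * (sqrt (real n) / real n) + K\<^sup>2 / real n)
        \<longlonglongrightarrow> 0" by simp
  qed auto
  then show ?thesis by (simp add: LIM_zero_iff)
qed

subsection \<open>The central limit theorem\<close>

lemma norm_expectation_le:
  fixes G :: "'a \<Rightarrow> 'b::{banach, second_countable_topology}"
  assumes "past n G" and "\<And>\<omega>. norm (G \<omega>) \<le> b"
  shows "norm (\<integral>\<omega>. G \<omega> \<partial>M) \<le> b"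
proof -
  have "norm (\<integral>\<omega>. G \<omega> \<partial>M) \<le> (\<integral>\<omega>. norm (G \<omega>) \<partial>M)" by (rule integral_norm_bound)
  also have "\<dots> \<le> (\<integral>\<omega>. b \<partial>M)"
    by (intro integral_mono integrable_past[of n] past_const past_comp[of _ _ norm] assms)
  finally show ?thesis by (simp add: prob_space)
qed

text \<open>For \<open>f = 1 - \<theta>\<^sup>2 r / 2\<close>, the Poisson equation for \<open>r\<close> makes \<open>f\<close> an eigenfunction of the
  twisted kernel \<open>P\<^sub>i\<^sub>j exp (\<i> \<theta> d\<^sub>i\<^sub>j)\<close> up to third order.\<close>

definition corrector :: "real \<Rightarrow> 's \<Rightarrow> complex" where
  "corrector \<theta> j = of_real (1 - \<theta>\<^sup>2 / 2 * r j)"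

definition eigval :: "real \<Rightarrow> complex" where
  "eigval \<theta> = of_real (1 - \<theta>\<^sup>2 / 2 * s)"

text \<open>The summands come from the cubic Taylor remainder of the exponential, from its deviation
  from 1 times the correction by \<open>r\<close>, and from the product of the second-order terms of
  \<open>eigval\<close> and \<open>corrector\<close>.\<close>

definition third_order :: real where
  "third_order = c ^ 3 / 6 + c * R / 2 + \<bar>s\<bar> * R / 4"

lemma norm_corrector: "norm (corrector \<theta> j - 1) \<le> \<theta>\<^sup>2 / 2 * R"
proof -
  have "corrector \<theta> j - 1 = of_real (- (\<theta>\<^sup>2 / 2 * r j))" by (simp add: corrector_def)
  then have "norm (corrector \<theta> j - 1) = \<theta>\<^sup>2 / 2 * \<bar>r j\<bar>"
    by (simp only: norm_of_real) (simp add: abs_mult)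
  also have "\<dots> \<le> \<theta>\<^sup>2 / 2 * R" by (intro mult_left_mono r_bound) simp
  finally show ?thesis .
qed

lemma twisted_kernel:
  assumes \<theta>: "\<bar>\<theta>\<bar> \<le> 1"
  shows "norm ((\<Sum>j\<in>UNIV. P $ i $ j *\<^sub>R (iexp (\<theta> * d i j) * corrector \<theta> j))
    - eigval \<theta> * corrector \<theta> i) \<le> third_order * \<bar>\<theta>\<bar> ^ 3"
proof -
  \<comment> \<open>\<open>Q\<close> is the second-order part of
    \<open>iexp (\<theta> * d i j) * corrector \<theta> j\<close>. Its one-step mean is given by
    \<open>P_poly\<close>, as the square of \<open>d\<close> occurs only together with
    \<open>r\<close>.\<close>
  define Q where "Q j = of_real (1 - \<theta>\<^sup>2 / 2 * ((d i j)\<^sup>2 + r j)) + \<i> * of_real (\<theta> * d i j)" for j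
  define E where "E j = iexp (\<theta> * d i j) * corrector \<theta> j - Q j" for j
  have E_le: "norm (E j) \<le> (c ^ 3 / 6 + c * R / 2) * \<bar>\<theta>\<bar> ^ 3" for j
  proof -
    let ?x = "\<theta> * d i j"
    have x_le: "\<bar>?x\<bar> \<le> \<bar>\<theta>\<bar> * c" unfolding abs_mult by (intro mult_left_mono d_bound) simp
    have A2: "cmod (iexp ?x - (1 + \<i> * ?x - ?x\<^sup>2 / 2)) \<le> \<bar>?x\<bar> ^ 3 / 6"
      using iexp_approx1[of ?x 2] by (simp add: numeral_2_eq_2 numeral_3_eq_3 power2_eq_square algebra_simps)
    have A0: "cmod (iexp ?x - 1) \<le> \<bar>?x\<bar>"
      using iexp_approx1[of ?x 0] by simp
    have "E j = (iexp ?x - (1 + \<i> * ?x - ?x\<^sup>2 / 2)) - (iexp ?x - 1) * of_real (\<theta>\<^sup>2 / 2 * r j)"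
      by (simp add: E_def Q_def corrector_def field_simps power_mult_distrib)
    then have "norm (E j) \<le> norm (iexp ?x - (1 + \<i> * ?x - ?x\<^sup>2 / 2))
        + norm ((iexp ?x - 1) * of_real (\<theta>\<^sup>2 / 2 * r j))"
      by (simp only: norm_triangle_ineq4)
    also have "\<dots> \<le> (\<bar>\<theta>\<bar> * c) ^ 3 / 6 + (\<bar>\<theta>\<bar> * c) * (\<theta>\<^sup>2 / 2 * R)"
      unfolding norm_mult
    proof (intro add_mono mult_mono)
      show "norm (iexp ?x - (1 + \<i> * ?x - ?x\<^sup>2 / 2)) \<le> (\<bar>\<theta>\<bar> * c) ^ 3 / 6"
        using power_mono[OF x_le abs_ge_zero, of 3] A2 by simp
      show "norm (iexp ?x - 1) \<le> \<bar>\<theta>\<bar> * c" using A0 x_le by simp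
      have "norm (of_real (\<theta>\<^sup>2 / 2 * r j) :: complex) = \<theta>\<^sup>2 / 2 * \<bar>r j\<bar>"
        by (simp only: norm_of_real) (simp add: abs_mult)
      then show "norm (of_real (\<theta>\<^sup>2 / 2 * r j) :: complex) \<le> \<theta>\<^sup>2 / 2 * R"
        using mult_left_mono[OF r_bound, of "\<theta>\<^sup>2 / 2" j] by simp
    qed (auto simp: c_nonneg)
    also have "\<dots> = (c ^ 3 / 6 + c * R / 2) * \<bar>\<theta>\<bar> ^ 3"
      using power2_abs[of \<theta>] by (simp add: power_mult_distrib power3_eq_cube power2_eq_square algebra_simps)
    finally show ?thesis .
  qed
  have Q_sum: "(\<Sum>j\<in>UNIV. P $ i $ j *\<^sub>R Q j) = of_real (1 - \<theta>\<^sup>2 / 2 * (s + r i))"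
  proof -
    have "(\<Sum>j\<in>UNIV. P $ i $ j *\<^sub>R Q j) =
      of_real (\<Sum>j\<in>UNIV. P $ i $ j * (1 + 0 * d i j + (- (\<theta>\<^sup>2 / 2)) * ((d i j)\<^sup>2 + r j)))
      + \<i> * of_real (\<Sum>j\<in>UNIV. P $ i $ j * (0 + \<theta> * d i j + 0 * ((d i j)\<^sup>2 + r j)))"
      unfolding of_real_sum sum_distrib_left sum.distrib[symmetric]
      by (intro sum.cong) (auto simp: Q_def scaleR_conv_of_real algebra_simps)
    then show ?thesis unfolding P_poly by simp
  qed
  have "(\<Sum>j\<in>UNIV. P $ i $ j *\<^sub>R (iexp (\<theta> * d i j) * corrector \<theta> j)) =
     (\<Sum>j\<in>UNIV. P $ i $ j *\<^sub>R Q j) + (\<Sum>j\<in>UNIV. P $ i $ j *\<^sub>R E j)"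
    by (simp add: E_def sum.distrib[symmetric] scaleR_add_right[symmetric])
  moreover have "eigval \<theta> * corrector \<theta> i =
      of_real (1 - \<theta>\<^sup>2 / 2 * (s + r i)) + of_real (\<theta> ^ 4 / 4 * s * r i)"
    by (simp add: eigval_def corrector_def field_simps power2_eq_square power4_eq_xxxx)
  ultimately have "(\<Sum>j\<in>UNIV. P $ i $ j *\<^sub>R (iexp (\<theta> * d i j) * corrector \<theta> j))
      - eigval \<theta> * corrector \<theta> i =
      (\<Sum>j\<in>UNIV. P $ i $ j *\<^sub>R E j) - of_real (\<theta> ^ 4 / 4 * s * r i)"
    unfolding Q_sum by (simp only: add_diff_add diff_self add_0_left)
  also have "norm \<dots> \<le> norm (\<Sum>j\<in>UNIV. P $ i $ j *\<^sub>R E j) + norm (of_real (\<theta> ^ 4 / 4 * s * r i) :: complex)"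
    by (rule norm_triangle_ineq4)
  also have "norm (\<Sum>j\<in>UNIV. P $ i $ j *\<^sub>R E j) \<le>
      (\<Sum>j\<in>UNIV. P $ i $ j * ((c ^ 3 / 6 + c * R / 2) * \<bar>\<theta>\<bar> ^ 3))"
    by (rule sum_norm_le) (simp add: transition_nonneg, intro mult_left_mono E_le transition_nonneg)
  also have "\<dots> = (c ^ 3 / 6 + c * R / 2) * \<bar>\<theta>\<bar> ^ 3"
    by (simp add: sum_distrib_right[symmetric] transition_row)
  also have "norm (of_real (\<theta> ^ 4 / 4 * s * r i) :: complex) = \<bar>\<theta>\<bar> ^ 4 * (\<bar>s\<bar> * \<bar>r i\<bar> / 4)"
    by (simp only: norm_of_real) (simp add: abs_mult power_abs)
  also have "\<dots> \<le> \<bar>\<theta>\<bar> ^ 3 * (\<bar>s\<bar> * R / 4)"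
    using \<theta> r_bound[of i] by (intro mult_mono divide_right_mono mult_left_mono power_decreasing) auto
  finally show ?thesis by (simp add: third_order_def algebra_simps)
qed

definition twisted_mean :: "real \<Rightarrow> nat \<Rightarrow> complex" where
  "twisted_mean \<theta> n = (\<integral>\<omega>. iexp (\<theta> * W n \<omega>) * corrector \<theta> (X n \<omega>) \<partial>M)"

lemma past_iexp_W: "m \<le> n \<Longrightarrow> past n (\<lambda>\<omega>. iexp (\<theta> * W m \<omega>))"
  by (rule past_comp[OF past_partial_sum])

lemma past_corrector: "m \<le> n \<Longrightarrow> past n (\<lambda>\<omega>. corrector \<theta> (X m \<omega>))"
  by (rule past_X_comp)

lemma twisted_mean_Suc:
  assumes \<theta>: "\<bar>\<theta>\<bar> \<le> 1"
  shows "norm (twisted_mean \<theta> (Suc n) - eigval \<theta> * twisted_mean \<theta> n) \<le> third_order * \<bar>\<theta>\<bar> ^ 3"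
proof -
  let ?A = "\<lambda>i. \<Sum>j\<in>UNIV. P $ i $ j *\<^sub>R (iexp (\<theta> * d i j) * corrector \<theta> j)"
  let ?F = "\<lambda>\<omega> j. iexp (\<theta> * (W n \<omega> + d (X n \<omega>) j)) * corrector \<theta> j"
  have past_A: "past n (\<lambda>\<omega>. ?A (X n \<omega>))" by (rule past_X_comp) simp
  have past_F: "past n (\<lambda>\<omega>. ?F \<omega> j)" for j
    by (rule past_comp2[OF past_partial_sum past_X, of _ _ _ "\<lambda>x i. iexp (\<theta> * (x + d i j)) * corrector \<theta> j"]) auto
  have "twisted_mean \<theta> (Suc n) = (\<integral>\<omega>. ?F \<omega> (X (Suc n) \<omega>) \<partial>M)"
    by (simp add: twisted_mean_def partial_sum_Suc)
  also have "\<dots> = (\<integral>\<omega>. (\<Sum>j\<in>UNIV. P $ X n \<omega> $ j *\<^sub>R ?F \<omega> j) \<partial>M)"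
    by (rule one_step[OF past_F])
  also have "\<dots> = (\<integral>\<omega>. iexp (\<theta> * W n \<omega>) * ?A (X n \<omega>) \<partial>M)"
    by (intro Bochner_Integration.integral_cong refl)
      (simp add: sum_distrib_left distrib_left exp_add mult_scaleR_right mult.assoc)
  finally have "twisted_mean \<theta> (Suc n) - eigval \<theta> * twisted_mean \<theta> n =
     (\<integral>\<omega>. iexp (\<theta> * W n \<omega>) * ?A (X n \<omega>) \<partial>M)
      - (\<integral>\<omega>. eigval \<theta> * (iexp (\<theta> * W n \<omega>) * corrector \<theta> (X n \<omega>)) \<partial>M)"
    by (simp add: twisted_mean_def)
  also have "\<dots> = (\<integral>\<omega>. iexp (\<theta> * W n \<omega>) * ?A (X n \<omega>)
      - eigval \<theta> * (iexp (\<theta> * W n \<omega>) * corrector \<theta> (X n \<omega>)) \<partial>M)"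
    by (intro Bochner_Integration.integral_diff[symmetric] integrable_past[of n] past_arith
        past_iexp_W past_corrector past_A order_refl)
  also have "norm \<dots> \<le> third_order * \<bar>\<theta>\<bar> ^ 3"
  proof (rule norm_expectation_le[of n])
    show "past n (\<lambda>\<omega>. iexp (\<theta> * W n \<omega>) * ?A (X n \<omega>)
        - eigval \<theta> * (iexp (\<theta> * W n \<omega>) * corrector \<theta> (X n \<omega>)))"
      by (intro past_arith past_iexp_W past_corrector past_A order_refl)
    fix \<omega>
    have "norm (iexp (\<theta> * W n \<omega>) * ?A (X n \<omega>) - eigval \<theta> * (iexp (\<theta> * W n \<omega>) * corrector \<theta> (X n \<omega>)))
      = norm (iexp (\<theta> * W n \<omega>) * (?A (X n \<omega>) - eigval \<theta> * corrector \<theta> (X n \<omega>)))"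
      by (simp only: right_diff_distrib mult.left_commute)
    also have "\<dots> \<le> third_order * \<bar>\<theta>\<bar> ^ 3"
      using twisted_kernel[OF \<theta>, of "X n \<omega>"] by (simp only: norm_mult norm_exp_i_times mult_1_left)
    finally show "norm (iexp (\<theta> * W n \<omega>) * ?A (X n \<omega>)
      - eigval \<theta> * (iexp (\<theta> * W n \<omega>) * corrector \<theta> (X n \<omega>))) \<le> third_order * \<bar>\<theta>\<bar> ^ 3" .
  qed
  finally show ?thesis .
qed

text \<open>Multiplication by \<open>eigval \<theta>\<close> does not enlarge errors, so the
  one-step errors merely add up. For \<theta> of order \<open>1 / sqrt n\<close> their total still
  tends to 0.\<close>

lemma twisted_mean_power:
  assumes \<theta>: "\<bar>\<theta>\<bar> \<le> 1" and eig: "norm (eigval \<theta>) \<le> 1"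
  shows "norm (twisted_mean \<theta> n - eigval \<theta> ^ n * twisted_mean \<theta> 0) \<le> real n * (third_order * \<bar>\<theta>\<bar> ^ 3)"
proof (induction n)
  case (Suc n)
  have "twisted_mean \<theta> (Suc n) - eigval \<theta> ^ Suc n * twisted_mean \<theta> 0 =
     (twisted_mean \<theta> (Suc n) - eigval \<theta> * twisted_mean \<theta> n)
     + eigval \<theta> * (twisted_mean \<theta> n - eigval \<theta> ^ n * twisted_mean \<theta> 0)"
    by (simp add: algebra_simps)
  then have "norm (twisted_mean \<theta> (Suc n) - eigval \<theta> ^ Suc n * twisted_mean \<theta> 0)
     \<le> norm (twisted_mean \<theta> (Suc n) - eigval \<theta> * twisted_mean \<theta> n)
     + norm (eigval \<theta>) * norm (twisted_mean \<theta> n - eigval \<theta> ^ n * twisted_mean \<theta> 0)"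
    by (metis norm_mult norm_triangle_ineq)
  also have "\<dots> \<le> third_order * \<bar>\<theta>\<bar> ^ 3 + 1 * (real n * (third_order * \<bar>\<theta>\<bar> ^ 3))"
    by (intro add_mono mult_mono twisted_mean_Suc \<theta> eig Suc) auto
  finally show ?case by (simp add: algebra_simps)
qed simp

text \<open>The first error term pays for the boundary term. The second consists of two halves, for
  replacing the corrector by 1 at time \<open>n\<close> and at time 0. The third is the accumulated
  error of the eigenvalue iteration.\<close>

lemma char_approx:
  fixes h :: "'s \<Rightarrow> real"
  assumes h: "\<And>i. \<bar>h i\<bar> \<le> H" and \<theta>: "\<bar>\<theta>\<bar> \<le> 1" and eig: "norm (eigval \<theta>) \<le> 1"
  shows "norm ((\<integral>\<omega>. iexp (\<theta> * (W n \<omega> + (h (X 0 \<omega>) - h (X n \<omega>)))) \<partial>M) - eigval \<theta> ^ n)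
    \<le> 2 * H * \<bar>\<theta>\<bar> + R * \<theta>\<^sup>2 + third_order * (real n * \<bar>\<theta>\<bar> ^ 3)"
proof -
  let ?B = "\<lambda>\<omega>. h (X 0 \<omega>) - h (X n \<omega>)"
  let ?L = "\<integral>\<omega>. iexp (\<theta> * (W n \<omega> + ?B \<omega>)) \<partial>M"
  have past_B: "past n ?B" by (intro past_arith past_X_comp) auto
  have past_L: "past n (\<lambda>\<omega>. iexp (\<theta> * (W n \<omega> + ?B \<omega>)))"
    by (rule past_comp2[OF past_partial_sum past_B]) simp
  have 1: "norm (?L - twisted_mean \<theta> n) \<le> 2 * H * \<bar>\<theta>\<bar> + \<theta>\<^sup>2 / 2 * R"
  proof -
    have "?L - twisted_mean \<theta> n = (\<integral>\<omega>. iexp (\<theta> * (W n \<omega> + ?B \<omega>))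
        - iexp (\<theta> * W n \<omega>) * corrector \<theta> (X n \<omega>) \<partial>M)"
      unfolding twisted_mean_def
      by (intro Bochner_Integration.integral_diff[symmetric] integrable_past[of n] past_arith
          past_iexp_W past_corrector past_L order_refl)
    also have "norm \<dots> \<le> 2 * H * \<bar>\<theta>\<bar> + \<theta>\<^sup>2 / 2 * R"
    proof (rule norm_expectation_le[of n])
      show "past n (\<lambda>\<omega>. iexp (\<theta> * (W n \<omega> + ?B \<omega>)) - iexp (\<theta> * W n \<omega>) * corrector \<theta> (X n \<omega>))"
        by (intro past_arith past_iexp_W past_corrector past_L order_refl)
      fix \<omega>
      have "iexp (\<theta> * (W n \<omega> + ?B \<omega>)) - iexp (\<theta> * W n \<omega>) * corrector \<theta> (X n \<omega>) =
        iexp (\<theta> * W n \<omega>) * ((iexp (\<theta> * ?B \<omega>) - 1) - (corrector \<theta> (X n \<omega>) - 1))"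
        by (simp add: distrib_left exp_add right_diff_distrib)
      then have "norm (iexp (\<theta> * (W n \<omega> + ?B \<omega>)) - iexp (\<theta> * W n \<omega>) * corrector \<theta> (X n \<omega>))
        = norm ((iexp (\<theta> * ?B \<omega>) - 1) - (corrector \<theta> (X n \<omega>) - 1))"
        by (simp only: norm_mult norm_exp_i_times mult_1_left)
      also have "\<dots> \<le> norm (iexp (\<theta> * ?B \<omega>) - 1) + norm (corrector \<theta> (X n \<omega>) - 1)"
        by (rule norm_triangle_ineq4)
      also have "\<dots> \<le> 2 * H * \<bar>\<theta>\<bar> + \<theta>\<^sup>2 / 2 * R"
      proof (intro add_mono norm_corrector)
        have "norm (iexp (\<theta> * ?B \<omega>) - 1) \<le> \<bar>\<theta> * ?B \<omega>\<bar>"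
          using iexp_approx1[of "\<theta> * ?B \<omega>" 0] by simp
        also have "\<dots> \<le> \<bar>\<theta>\<bar> * (2 * H)"
          unfolding abs_mult using h[of "X 0 \<omega>"] h[of "X n \<omega>"] by (intro mult_left_mono) auto
        finally show "norm (iexp (\<theta> * ?B \<omega>) - 1) \<le> 2 * H * \<bar>\<theta>\<bar>" by (simp add: mult.commute)
      qed
      finally show "norm (iexp (\<theta> * (W n \<omega> + ?B \<omega>)) - iexp (\<theta> * W n \<omega>) * corrector \<theta> (X n \<omega>))
        \<le> 2 * H * \<bar>\<theta>\<bar> + \<theta>\<^sup>2 / 2 * R" .
    qed
    finally show ?thesis .
  qed
  have 2: "norm (eigval \<theta> ^ n * twisted_mean \<theta> 0 - eigval \<theta> ^ n) \<le> \<theta>\<^sup>2 / 2 * R"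
  proof -
    have "twisted_mean \<theta> 0 - 1 = (\<integral>\<omega>. corrector \<theta> (X 0 \<omega>) - 1 \<partial>M)"
      using integrable_past[OF past_corrector[of 0 0]]
      by (subst Bochner_Integration.integral_diff) (auto simp: twisted_mean_def partial_sum_0 prob_space)
    also have "norm \<dots> \<le> \<theta>\<^sup>2 / 2 * R"
      by (rule norm_expectation_le[of 0]) (intro past_arith past_corrector order_refl norm_corrector)+
    finally have "norm (twisted_mean \<theta> 0 - 1) \<le> \<theta>\<^sup>2 / 2 * R" .
    moreover have "norm (eigval \<theta>) ^ n \<le> 1" using eig by (intro power_le_one) auto
    ultimately have "norm (eigval \<theta> ^ n * (twisted_mean \<theta> 0 - 1)) \<le> 1 * (\<theta>\<^sup>2 / 2 * R)"
      unfolding norm_mult norm_power by (intro mult_mono) auto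
    then show ?thesis by (simp add: algebra_simps)
  qed
  have "norm (?L - eigval \<theta> ^ n) \<le> norm (?L - twisted_mean \<theta> n)
     + norm (twisted_mean \<theta> n - eigval \<theta> ^ n * twisted_mean \<theta> 0)
     + norm (eigval \<theta> ^ n * twisted_mean \<theta> 0 - eigval \<theta> ^ n)"
    using norm_triangle_ineq[of "?L - twisted_mean \<theta> n" "twisted_mean \<theta> n - eigval \<theta> ^ n"]
      norm_triangle_ineq[of "twisted_mean \<theta> n - eigval \<theta> ^ n * twisted_mean \<theta> 0"
        "eigval \<theta> ^ n * twisted_mean \<theta> 0 - eigval \<theta> ^ n"] by simp
  with 1 2 twisted_mean_power[OF \<theta> eig, of n] show ?thesis by (simp add: algebra_simps)
qed

lemma central_limit:
  fixes h :: "'s \<Rightarrow> real"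
  assumes h: "\<And>i. \<bar>h i\<bar> \<le> H" and s: "0 < s"
  shows "weak_conv_m (\<lambda>n. distr M borel (\<lambda>\<omega>. (W n \<omega> + (h (X 0 \<omega>) - h (X n \<omega>))) / sqrt (real n * s)))
    std_normal_distribution"
proof (rule levy_continuity)
  let ?U = "\<lambda>n \<omega>. W n \<omega> + (h (X 0 \<omega>) - h (X n \<omega>))"
  have past_U: "past n (?U n)" for n
    by (intro past_arith past_partial_sum past_X_comp) auto
  have meas [measurable]: "?U n \<in> borel_measurable M" for n
    using integrable_past[OF past_U] by (rule borel_measurable_integrable)
  show "real_distribution (distr M borel (\<lambda>\<omega>. ?U n \<omega> / sqrt (real n * s)))" for n
    by (intro real_distribution_distr) measurable
  show "real_distribution std_normal_distribution" by (rule real_dist_normal_dist)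
  fix t :: real
  define a where "a = t / sqrt s"
  define \<theta> where "\<theta> n = a / sqrt (real n)" for n
  have char: "char (distr M borel (\<lambda>\<omega>. ?U n \<omega> / sqrt (real n * s))) t = (\<integral>\<omega>. iexp (\<theta> n * ?U n \<omega>) \<partial>M)" for n
    unfolding char_def by (subst integral_distr) (auto simp: \<theta>_def a_def real_sqrt_mult mult.commute)
  have \<theta>0: "\<theta> \<longlonglongrightarrow> 0" unfolding \<theta>_def
    by (intro tendsto_divide_0[OF tendsto_const] filterlim_at_top_imp_at_infinity) real_asymp
  have ev1: "\<forall>\<^sub>F n in sequentially. \<bar>\<theta> n\<bar> \<le> 1"
    using tendstoD[OF \<theta>0, of 1] by (auto elim: eventually_mono)
  have "(\<lambda>n. (\<theta> n)\<^sup>2 * s) \<longlonglongrightarrow> 0\<^sup>2 * s" by (intro tendsto_intros \<theta>0)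
  \<comment> \<open>For \<open>x \<ge> 0\<close>, the bound \<open>x \<le> 4\<close> is exactly what
    keeps \<open>1 - x / 2\<close> in the unit disc.\<close>
  from tendstoD[OF this, of 4] have "\<forall>\<^sub>F n in sequentially. (\<theta> n)\<^sup>2 * s \<le> 4"
    by (auto elim!: eventually_mono)
  then have ev2: "\<forall>\<^sub>F n in sequentially. norm (eigval (\<theta> n)) \<le> 1"
  proof eventually_elim
    case (elim n)
    moreover have "0 \<le> (\<theta> n)\<^sup>2 * s" using s by simp
    ultimately have "\<bar>1 - (\<theta> n)\<^sup>2 / 2 * s\<bar> \<le> 1" by (simp add: abs_le_iff)
    then show ?case by (simp only: eigval_def norm_of_real)
  qed
  have "(\<lambda>n. 2 * H * \<bar>\<theta> n\<bar> + R * (\<theta> n)\<^sup>2 + third_order * (real n * \<bar>\<theta> n\<bar> ^ 3)) \<longlonglongrightarrow> 0"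
  proof -
    have "(\<lambda>n. real n * \<bar>\<theta> n\<bar> ^ 3) = (\<lambda>n. \<bar>a\<bar> ^ 3 * (real n / sqrt (real n) ^ 3))"
      by (simp add: \<theta>_def power_divide mult.commute)
    moreover have "(\<lambda>n. real n / sqrt (real n) ^ 3) \<longlonglongrightarrow> 0" by real_asymp
    ultimately have "(\<lambda>n. real n * \<bar>\<theta> n\<bar> ^ 3) \<longlonglongrightarrow> 0"
      by (simp only: tendsto_mult_right_zero)
    then have "(\<lambda>n. 2 * H * \<bar>\<theta> n\<bar> + R * (\<theta> n)\<^sup>2 + third_order * (real n * \<bar>\<theta> n\<bar> ^ 3))
      \<longlonglongrightarrow> 2 * H * \<bar>0\<bar> + R * 0\<^sup>2 + third_order * 0"
      by (intro tendsto_intros \<theta>0)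
    then show ?thesis by simp
  qed
  then have lim: "(\<lambda>n. char (distr M borel (\<lambda>\<omega>. ?U n \<omega> / sqrt (real n * s))) t - eigval (\<theta> n) ^ n) \<longlonglongrightarrow> 0"
  proof (rule Lim_null_comparison[rotated])
    show "\<forall>\<^sub>F n in sequentially. norm (char (distr M borel (\<lambda>\<omega>. ?U n \<omega> / sqrt (real n * s))) t
        - eigval (\<theta> n) ^ n) \<le> 2 * H * \<bar>\<theta> n\<bar> + R * (\<theta> n)\<^sup>2 + third_order * (real n * \<bar>\<theta> n\<bar> ^ 3)"
      using ev1 ev2 unfolding char by eventually_elim (rule char_approx[OF h])
  qed
  have "(\<lambda>n. (1 + (- (t\<^sup>2 / 2)) / real n) ^ n) \<longlonglongrightarrow> exp (- (t\<^sup>2 / 2))"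
    by (rule tendsto_exp_limit_sequentially)
  \<comment> \<open>This includes \<open>n = 0\<close>, where division by zero makes both sides
    equal to 1.\<close>
  moreover have "1 + (- (t\<^sup>2 / 2)) / real n = 1 - (\<theta> n)\<^sup>2 / 2 * s" for n
    using s by (simp add: \<theta>_def a_def power_divide power_mult_distrib)
  ultimately have "(\<lambda>n. (1 - (\<theta> n)\<^sup>2 / 2 * s) ^ n) \<longlonglongrightarrow> exp (- (t\<^sup>2 / 2))" by (simp only:)
  then have "(\<lambda>n. of_real ((1 - (\<theta> n)\<^sup>2 / 2 * s) ^ n)) \<longlonglongrightarrow> complex_of_real (exp (- (t\<^sup>2 / 2)))"
    by (rule tendsto_of_real)
  then have "(\<lambda>n. eigval (\<theta> n) ^ n) \<longlonglongrightarrow> char std_normal_distribution t"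
    by (simp only: eigval_def of_real_power char_std_normal_distribution minus_divide_left)
  from tendsto_add[OF lim this]
  show "(\<lambda>n. char (distr M borel (\<lambda>\<omega>. ?U n \<omega> / sqrt (real n * s))) t)
      \<longlonglongrightarrow> char std_normal_distribution t" by simp
qed

end

subsection \<open>Oscillation\<close>

lemma limsup_unbounded:
  fixes f :: "nat \<Rightarrow> real"
  assumes "\<And>K. \<exists>n\<ge>K. real K \<le> f n"
  shows "limsup (\<lambda>n. ereal (f n)) = \<infinity>"
proof -
  have "(SUP n\<in>{m..}. ereal (f n)) = \<infinity>" for m
  proof (rule SUP_PInfty)
    fix k :: nat
    obtain n where "n \<ge> max m k" "real (max m k) \<le> f n" using assms by blast
    then show "\<exists>i\<in>{m..}. ereal (real k) \<le> ereal (f i)" by (intro bexI[of _ n]) auto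
  qed
  then show ?thesis by (simp add: limsup_INF_SUP)
qed

text \<open>The quartic lies below a multiple of the indicator of \<open>{a..}\<close>; integrating it bounds a tail
  probability from below by the first, second and fourth moments.\<close>

lemma quartic_below_indicator:
  fixes A \<epsilon> :: real
  assumes "0 < A" "0 < \<epsilon>"
  obtains a G where "0 < a" "0 < G"
    "\<And>y. y\<^sup>2 + A * y - y ^ 4 / A\<^sup>2 - \<epsilon> \<le> G * of_bool (a \<le> y)"
proof
  \<comment> \<open>For \<open>0 \<le> y < ?a\<close> one has \<open>y \<le> 1\<close>, hence
    \<open>y\<^sup>2 + A * y \<le> (1 + A) * y \<le> \<epsilon>\<close>.\<close>
  let ?a = "min 1 (\<epsilon> / (1 + A))"
  \<comment> \<open>The maximum of \<open>(1 + A / 2) * y\<^sup>2 - y ^ 4 / A\<^sup>2\<close>, found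
    by completing the square in \<open>y\<^sup>2\<close>, plus the \<open>A / 2\<close> left over
    from \<open>A * y \<le> A / 2 * y\<^sup>2 + A / 2\<close>.\<close>
  let ?G = "(1 + A / 2)\<^sup>2 * A\<^sup>2 / 4 + A / 2"
  show "0 < ?a" using assms by simp
  show "0 < ?G" using assms by (simp add: add_nonneg_pos)
  fix y :: real
  show "y\<^sup>2 + A * y - y ^ 4 / A\<^sup>2 - \<epsilon> \<le> ?G * of_bool (?a \<le> y)"
  proof (cases "?a \<le> y")
    case True
    have "0 \<le> (y\<^sup>2 / A - (1 + A / 2) * A / 2)\<^sup>2" by simp
    also have "\<dots> = y ^ 4 / A\<^sup>2 - (1 + A / 2) * y\<^sup>2 + (1 + A / 2)\<^sup>2 * A\<^sup>2 / 4"
      using assms by (simp add: power2_eq_square power4_eq_xxxx field_simps)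
    finally have "y\<^sup>2 + A / 2 * y\<^sup>2 - y ^ 4 / A\<^sup>2 \<le> (1 + A / 2)\<^sup>2 * A\<^sup>2 / 4"
      by (simp add: algebra_simps)
    moreover have "A * y \<le> A / 2 * y\<^sup>2 + A / 2"
    proof -
      have "0 \<le> A / 2 * (y - 1)\<^sup>2" using assms by simp
      then show ?thesis by (simp add: power2_eq_square algebra_simps)
    qed
    ultimately have "y\<^sup>2 + A * y - y ^ 4 / A\<^sup>2 - \<epsilon> \<le> ?G" using assms by linarith
    then show ?thesis using True by simp
  next
    case False
    have "y\<^sup>2 + A * y - y ^ 4 / A\<^sup>2 \<le> \<epsilon>"
    proof (cases "0 \<le> y")
      case True
      have "y\<^sup>2 + A * y \<le> (1 + A) * y"
        using True False by (simp add: power2_eq_square algebra_simps mult_left_le)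
      also have "\<dots> \<le> (1 + A) * (\<epsilon> / (1 + A))"
        using False assms by (intro mult_left_mono) auto
      also have "\<dots> = \<epsilon>" using assms by simp
      finally have "y\<^sup>2 + A * y \<le> \<epsilon>" .
      moreover have "0 \<le> y ^ 4 / A\<^sup>2" by simp
      ultimately show ?thesis by linarith
    next
      case neg: False
      show ?thesis
      \<comment> \<open>On \<open>[-A, 0]\<close> the linear term outweighs the square; below
        \<open>-A\<close> the quartic term does.\<close>
      proof (cases "- y \<le> A")
        case True
        then have "(- y) * (- y) \<le> A * (- y)" using neg by (intro mult_right_mono) auto
        then have "y\<^sup>2 + A * y \<le> 0" by (simp add: power2_eq_square)
        moreover have "0 \<le> y ^ 4 / A\<^sup>2" by simp
        ultimately show ?thesis using assms by linarith
      next
        case False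
        then have "A\<^sup>2 \<le> y\<^sup>2" using assms by (metis less_eq_real_def linorder_not_le power2_minus power_mono)
        then have "y\<^sup>2 * A\<^sup>2 \<le> y\<^sup>2 * y\<^sup>2" by (intro mult_left_mono) auto
        then have "y\<^sup>2 \<le> y ^ 4 / A\<^sup>2" using assms by (simp add: pos_le_divide_eq flip: power_add)
        moreover have "A * y \<le> 0" using neg assms by (simp add: mult_le_0_iff)
        ultimately show ?thesis using assms by linarith
      qed
    qed
    with False show ?thesis by simp
  qed
qed

context markov_martingale
begin

text \<open>A one-sided, conditional Paley-Zygmund bound: the quartic inequality is applied to
  \<open>incr m k \<omega> / sqrt (real k)\<close> and integrated against \<open>Y\<close>. The
  constants do not depend on \<open>m\<close>, \<open>k\<close> or \<open>Y\<close>.\<close>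

lemma incr_tail:
  assumes s: "0 < s"
  obtains a \<delta> :: real and N :: nat where "0 < a" "0 < \<delta>" "\<delta> \<le> 1" "0 < N"
    "\<forall>m k Y. N \<le> k \<longrightarrow> past m Y \<longrightarrow> (\<forall>\<omega>. 0 \<le> Y \<omega>) \<longrightarrow>
      \<delta> * (\<integral>\<omega>. Y \<omega> \<partial>M) \<le> (\<integral>\<omega>. Y \<omega> * of_bool (a * sqrt (real k) \<le> incr m k \<omega>) \<partial>M)"
proof -
  \<comment> \<open>\<open>K\<close> dominates the constant of the fourth moment, and the added 1
    keeps it positive. \<open>A\<close> is then chosen so that the quartic term costs at most
    \<open>s / 8\<close>.\<close>
  define K where "K = 7 * c ^ 4 + 1"
  define A where "A = sqrt (8 * K / s)"
  have K: "1 \<le> K" "7 * c ^ 4 \<le> K" using c_nonneg by (auto simp: K_def)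
  have A2: "A\<^sup>2 = 8 * K / s" using K s by (simp add: A_def)
  have A: "0 < A" using K s by (simp add: A_def)
  obtain a G where aG: "0 < a" "0 < G"
    and quartic: "\<And>y. y\<^sup>2 + A * y - y ^ 4 / A\<^sup>2 - s / 8 \<le> G * of_bool (a \<le> y)"
    using quartic_below_indicator[OF A, of "s / 8"] s by auto
  \<comment> \<open>From \<open>N\<close> on, the boundary terms, at most \<open>2 * R\<close>, take
    away at most half of the variance \<open>k * s\<close>. The successor makes \<open>k\<close>
    positive.\<close>
  define N where "N = Suc (nat \<lceil>4 * R / s\<rceil>)"
  show ?thesis
  proof (rule that[of a "min 1 (s / (4 * G))" N], goal_cases)
    case 5
    show ?case
    proof (intro allI impI)
      fix m k :: nat and Y :: "'a \<Rightarrow> real"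
      assume k: "N \<le> k" and Y: "past m Y" and "\<forall>\<omega>. 0 \<le> Y \<omega>"
      then have nonneg: "\<And>\<omega>. 0 \<le> Y \<omega>" by blast
      let ?T = "incr m k" and ?EY = "\<integral>\<omega>. Y \<omega> \<partial>M"
      let ?I = "\<lambda>\<omega>. of_bool (a * sqrt (real k) \<le> ?T \<omega>) :: real"
      have Y': "past (m + k) Y" using past_mono[OF Y] by auto
      have EY: "0 \<le> ?EY" by (intro Bochner_Integration.integral_nonneg nonneg)
      have kpos: "0 < k" using k by (simp add: N_def)
      have past_I: "past (m + k) ?I"
        by (rule past_comp[OF past_incr, of _ _ _ "\<lambda>x. of_bool (a * sqrt (real k) \<le> x)"]) simp
      have "4 * R / s \<le> real k"
        using k unfolding N_def by linarith
      then have R_le: "2 * R \<le> real k * (s / 2)" using s by (simp add: field_simps)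
      have sq: "s / 2 * ?EY \<le> (\<integral>\<omega>. Y \<omega> * (?T \<omega>)\<^sup>2 \<partial>M) / real k"
      proof -
        have "- (2 * R * ?EY) = (\<integral>\<omega>. Y \<omega> * (- (2 * R)) \<partial>M)" by simp
        also have "\<dots> \<le> (\<integral>\<omega>. Y \<omega> * (r (X m \<omega>) - r (X (m + k) \<omega>)) \<partial>M)"
        proof (intro integral_mono integrable_past[of "m + k"] past_intros Y' mult_left_mono nonneg)
          show "- (2 * R) \<le> r (X m \<omega>) - r (X (m + k) \<omega>)" for \<omega>
            using r_bound[of "X m \<omega>"] r_bound[of "X (m + k) \<omega>"] by linarith
        qed auto
        finally have "real k * s * ?EY - 2 * R * ?EY \<le> (\<integral>\<omega>. Y \<omega> * (?T \<omega>)\<^sup>2 \<partial>M)"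
          using incr_square[OF Y, of k] by simp
        moreover have "2 * R * ?EY \<le> real k * (s / 2) * ?EY" by (rule mult_right_mono[OF R_le EY])
        ultimately have "real k * (s / 2 * ?EY) \<le> (\<integral>\<omega>. Y \<omega> * (?T \<omega>)\<^sup>2 \<partial>M)"
          by (simp add: algebra_simps)
        then show ?thesis using kpos by (simp add: pos_le_divide_eq mult.commute)
      qed
      have fourth: "(\<integral>\<omega>. Y \<omega> * (?T \<omega>) ^ 4 \<partial>M) / ((real k)\<^sup>2 * A\<^sup>2) \<le> s / 8 * ?EY"
      proof -
        have "(\<integral>\<omega>. Y \<omega> * (?T \<omega>) ^ 4 \<partial>M) \<le> 7 * c ^ 4 * (real k)\<^sup>2 * ?EY"
          by (rule incr_fourth_le[OF Y nonneg])
        also have "\<dots> \<le> K * (real k)\<^sup>2 * ?EY" using K EY by (intro mult_right_mono) auto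
        finally have "(\<integral>\<omega>. Y \<omega> * (?T \<omega>) ^ 4 \<partial>M) / ((real k)\<^sup>2 * A\<^sup>2)
            \<le> K * (real k)\<^sup>2 * ?EY / ((real k)\<^sup>2 * A\<^sup>2)"
          by (rule divide_right_mono) simp
        also have "\<dots> = s / 8 * ?EY" unfolding A2 using kpos K s by simp
        finally show ?thesis .
      qed
      \<comment> \<open>The balance is \<open>s / 2 - s / 8 - s / 8 = s / 4\<close>; the summand
        with factor 0 is the mean of the linear term.\<close>
      have "s / 4 * ?EY \<le> (\<integral>\<omega>. Y \<omega> * (?T \<omega>)\<^sup>2 \<partial>M) / real k + A / sqrt (real k) * 0
          - (\<integral>\<omega>. Y \<omega> * (?T \<omega>) ^ 4 \<partial>M) / ((real k)\<^sup>2 * A\<^sup>2) - s / 8 * ?EY"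
        using sq fourth by simp
      also have "\<dots> = (\<integral>\<omega>. Y \<omega> * (?T \<omega>)\<^sup>2 * (1 / real k) + A / sqrt (real k) * (Y \<omega> * ?T \<omega>)
          - Y \<omega> * (?T \<omega>) ^ 4 * (1 / ((real k)\<^sup>2 * A\<^sup>2)) - s / 8 * Y \<omega> \<partial>M)"
        by (subst Bochner_Integration.integral_diff Bochner_Integration.integral_add,
            (intro integrable_past[of "m + k"] past_intros Y'; simp)+)+ (simp add: incr_mean[OF Y])
      also have "\<dots> \<le> (\<integral>\<omega>. G * (Y \<omega> * ?I \<omega>) \<partial>M)"
      proof (intro integral_mono integrable_past[of "m + k"])
        fix \<omega>
        let ?y = "?T \<omega> / sqrt (real k)"
        have "Y \<omega> * (?y\<^sup>2 + A * ?y - ?y ^ 4 / A\<^sup>2 - s / 8) \<le> Y \<omega> * (G * of_bool (a \<le> ?y))"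
          by (intro mult_left_mono quartic nonneg)
        moreover have "a \<le> ?y \<longleftrightarrow> a * sqrt (real k) \<le> ?T \<omega>" using kpos by (simp add: pos_le_divide_eq)
        moreover have "?y\<^sup>2 = (?T \<omega>)\<^sup>2 / real k" by (simp add: power_divide)
        moreover have "sqrt (real k) ^ 4 = (real k)\<^sup>2"
          using power_mult[of "sqrt (real k)" 2 2] by simp
        then have "?y ^ 4 = ?T \<omega> ^ 4 / (real k)\<^sup>2" by (simp add: power_divide)
        ultimately show "Y \<omega> * (?T \<omega>)\<^sup>2 * (1 / real k) + A / sqrt (real k) * (Y \<omega> * ?T \<omega>)
          - Y \<omega> * (?T \<omega>) ^ 4 * (1 / ((real k)\<^sup>2 * A\<^sup>2)) - s / 8 * Y \<omega> \<le> G * (Y \<omega> * ?I \<omega>)"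
          by (simp add: algebra_simps)
      qed (intro past_intros Y' past_I; simp)+
      also have "\<dots> = G * (\<integral>\<omega>. Y \<omega> * ?I \<omega> \<partial>M)" by simp
      finally have "s / (4 * G) * ?EY \<le> (\<integral>\<omega>. Y \<omega> * ?I \<omega> \<partial>M)"
        using aG by (simp add: field_simps)
      moreover have "min 1 (s / (4 * G)) * ?EY \<le> s / (4 * G) * ?EY" by (intro mult_right_mono EY) simp
      ultimately show "min 1 (s / (4 * G)) * ?EY \<le> (\<integral>\<omega>. Y \<omega> * ?I \<omega> \<partial>M)" by linarith
    qed
  qed (use aG s in \<open>auto simp: N_def\<close>)
qed

text \<open>Along times \<open>\<tau> 0 < \<tau> 1 < \<dots>\<close> growing so fast that the typical size of
  \<open>W (\<tau> (k + 1)) - W (\<tau> k)\<close> exceeds the largest possible value of \<open>- W (\<tau> k)\<close>, each increment is large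
  with conditional probability at least \<open>\<delta>\<close> given the past.\<close>

lemma W_unbounded_above:
  assumes s: "0 < s"
  shows "AE \<omega> in M. \<forall>K. \<exists>n\<ge>K. real K \<le> W n \<omega>"
proof -
  obtain a \<delta> :: real and N :: nat where const: "0 < a" "0 < \<delta>" "\<delta> \<le> 1" "0 < N"
    and tail: "\<forall>m k Y. N \<le> k \<longrightarrow> past m Y \<longrightarrow> (\<forall>\<omega>. 0 \<le> Y \<omega>) \<longrightarrow>
      \<delta> * (\<integral>\<omega>. Y \<omega> \<partial>M) \<le> (\<integral>\<omega>. Y \<omega> * of_bool (a * sqrt (real k) \<le> incr m k \<omega>) \<partial>M)"
    by (rule incr_tail[OF s])
  have "\<exists>l\<ge>N. b \<le> a * sqrt (real l)" for b
  proof -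
    have "filterlim (\<lambda>l. a * sqrt (real l)) at_top sequentially"
      using const by (intro filterlim_tendsto_pos_mult_at_top[OF tendsto_const]
          filterlim_compose[OF sqrt_at_top filterlim_real_sequentially])
    then have "\<forall>\<^sub>F l in sequentially. b \<le> a * sqrt (real l)" by (simp add: filterlim_at_top)
    then show ?thesis by (auto simp: eventually_sequentially intro: max.cobounded1 max.cobounded2)
  qed
  then obtain len where len: "\<And>b. N \<le> len b" "\<And>b. b \<le> a * sqrt (real (len b))" by metis
  \<comment> \<open>The part \<open>c * real n\<close> covers the worst value at the start of the
    block; the extra \<open>real k\<close> makes successes in infinitely many blocks force
    unboundedness.\<close>
  define \<tau> where "\<tau> = rec_nat 0 (\<lambda>k n. n + len (c * real n + real k))"
  define l where "l k = len (c * real (\<tau> k) + real k)" for k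
  have \<tau>_Suc: "\<tau> (Suc k) = \<tau> k + l k" for k by (simp add: \<tau>_def l_def)
  have l_N: "N \<le> l k" for k by (simp add: l_def len)
  have l_sqrt: "c * real (\<tau> k) + real k \<le> a * sqrt (real (l k))" for k by (simp only: l_def len)
  have "\<tau> k < \<tau> (Suc k)" for k using l_N[of k] const by (simp add: \<tau>_Suc)
  then have \<tau>_mono: "strict_mono \<tau>" by (simp add: strict_mono_Suc_iff)
  define E where "E k \<omega> \<longleftrightarrow> a * sqrt (real (l k)) \<le> incr (\<tau> k) (l k) \<omega>" for k \<omega>
  have past_E: "past (\<tau> (Suc k)) (E k)" for k
    unfolding E_def[abs_def] by (rule past_comp[OF past_incr, of _ _ _ "\<lambda>x. _ \<le> x"]) (simp add: \<tau>_Suc)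
  \<comment> \<open>The indicator that none of the \<open>L\<close> blocks from \<open>K\<close> on
    succeeds. It is known when the next block starts, so it is an admissible weight in
    \<open>tail\<close>, and each block multiplies its mean by at most
    \<open>1 - \<delta>\<close>.\<close>
  define Y where "Y K L \<omega> = (\<Prod>k<L. 1 - of_bool (E (K + k) \<omega>) :: real)" for K L \<omega>
  have past_Y: "past (\<tau> (K + L)) (Y K L)" for K L
  proof (induction L)
    case 0 then show ?case by (simp add: Y_def[abs_def] past_const)
  next
    case (Suc L)
    have "past (\<tau> (K + Suc L)) (\<lambda>\<omega>. Y K L \<omega> * (1 - of_bool (E (K + L) \<omega>)))"
      using past_mono[OF Suc, of "\<tau> (K + Suc L)"] strict_mono_mono[OF \<tau>_mono] past_E[of "K + L"]
      by (intro past_arith past_comp[of _ _ of_bool]) (auto simp: mono_def)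
    then show ?case by (simp add: Y_def[abs_def])
  qed
  have Y_nonneg: "0 \<le> Y K L \<omega>" for K L \<omega> unfolding Y_def by (intro prod_nonneg) auto
  have EY: "(\<integral>\<omega>. Y K L \<omega> \<partial>M) \<le> (1 - \<delta>) ^ L" for K L
  proof (induction L)
    case 0 then show ?case by (simp add: Y_def prob_space)
  next
    case (Suc L)
    let ?m = "\<tau> (K + L)"
    have "past (\<tau> (Suc (K + L))) (\<lambda>\<omega>. Y K L \<omega> * of_bool (E (K + L) \<omega>))"
      using past_mono[OF past_Y, of K L "\<tau> (Suc (K + L))"] strict_mono_mono[OF \<tau>_mono] past_E[of "K + L"]
      by (intro past_arith past_comp[of _ _ of_bool]) (auto simp: mono_def)
    from integrable_past[OF this] integrable_past[OF past_Y]
    have "(\<integral>\<omega>. Y K (Suc L) \<omega> \<partial>M) = (\<integral>\<omega>. Y K L \<omega> \<partial>M) - (\<integral>\<omega>. Y K L \<omega> * of_bool (E (K + L) \<omega>) \<partial>M)"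
      by (subst Bochner_Integration.integral_diff[symmetric])
        (auto simp: Y_def fun_eq_iff right_diff_distrib intro!: Bochner_Integration.integral_cong)
    also have "\<dots> \<le> (1 - \<delta>) * (\<integral>\<omega>. Y K L \<omega> \<partial>M)"
      using tail[rule_format, OF l_N past_Y Y_nonneg, of K L "K + L"] by (simp add: E_def algebra_simps)
    also have "\<dots> \<le> (1 - \<delta>) * (1 - \<delta>) ^ L" using const by (intro mult_left_mono Suc) auto
    finally show ?case by simp
  qed
  have meas: "Measurable.pred M (E k)" for k
  proof -
    have "incr (\<tau> k) (l k) \<in> borel_measurable M"
      by (rule borel_measurable_integrable[OF integrable_past[OF past_incr[OF order_refl]]])
    then show ?thesis unfolding E_def[abs_def] by measurable
  qed
  have "AE \<omega> in M. \<exists>k\<ge>K. E k \<omega>" for K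
  proof -
    define A where "A = {\<omega> \<in> space M. \<not> (\<exists>k\<ge>K. E k \<omega>)}"
    have A: "A \<in> sets M" unfolding A_def using meas by measurable
    have "prob A \<le> (1 - \<delta>) ^ L" for L
    proof -
      have "prob A = (\<integral>\<omega>. indicat_real A \<omega> \<partial>M)" using A by simp
      also have "\<dots> \<le> (\<integral>\<omega>. Y K L \<omega> \<partial>M)"
      proof (intro integral_mono integrable_past[OF past_Y] integrable_real_indicator A)
        show "indicat_real A \<omega> \<le> Y K L \<omega>" for \<omega>
        proof (cases "\<omega> \<in> A")
          case True
          then have "Y K L \<omega> = 1" by (simp add: Y_def A_def)
          with True show ?thesis by simp
        qed (simp add: Y_nonneg)
      qed (simp add: emeasure_eq_measure)
      finally show ?thesis using EY order_trans by blast
    qed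
    moreover have "(\<lambda>L. (1 - \<delta>) ^ L) \<longlonglongrightarrow> 0" using const by (intro LIMSEQ_realpow_zero) auto
    ultimately have "prob A \<le> 0" by (intro LIMSEQ_le_const) auto
    then have "emeasure M A = 0" by (simp add: emeasure_eq_measure measure_le_0_iff)
    then show ?thesis by (subst AE_iff_measurable[OF A A_def[symmetric]])
  qed
  then have "AE \<omega> in M. \<forall>K. \<exists>k\<ge>K. E k \<omega>" by (simp add: AE_all_countable)
  then show ?thesis
  proof eventually_elim
    case (elim \<omega>)
    show ?case
    proof
      fix K
      obtain k where k: "k \<ge> K" "E k \<omega>" using elim by blast
      have "\<bar>W (\<tau> k) \<omega>\<bar> \<le> real (\<tau> k) * c"
        using partial_sum_bound[of d c X 0 "\<tau> k" \<omega>] d_bound by (simp add: partial_sum_0)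
      moreover have "W (\<tau> (Suc k)) \<omega> = W (\<tau> k) \<omega> + incr (\<tau> k) (l k) \<omega>"
        by (simp add: incr_def \<tau>_Suc)
      ultimately have "real k \<le> W (\<tau> (Suc k)) \<omega>"
        using k(2) l_sqrt[of k] by (simp add: E_def abs_le_iff mult.commute)
      moreover have "Suc k \<le> \<tau> (Suc k)" by (rule strict_mono_imp_increasing[OF \<tau>_mono])
      ultimately show "\<exists>n\<ge>K. real K \<le> W n \<omega>" using k(1) by (intro exI[of _ "\<tau> (Suc k)"]) auto
    qed
  qed
qed

end

subsection \<open>The limit theorems\<close>

theorem theorem1:
  fixes M :: "'a measure"
    and X :: "nat \<Rightarrow> 'a \<Rightarrow> 's :: finite"
    and P :: "real ^ 's ^ 's"
    and p :: "real ^ 's"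
    and w :: "'s \<Rightarrow> 's \<Rightarrow> real"
    and \<mu> \<sigma>2 :: real
    and S :: "nat \<Rightarrow> 'a \<Rightarrow> real"
  assumes chain: "markov_chain M P X"
    and irreducible: "irreducible_chain P"
    and aperiodic: "aperiodic_chain P"
    and stationary: "stationary_distribution P p"
    and \<mu>: "\<mu> = asymptotic_mean P p w"
    and \<sigma>2: "\<sigma>2 = asymptotic_variance P p w"
    and S: "S = partial_sum X w"
  shows "(\<lambda>n. prob_space.expectation M (S n) / real n) \<longlonglongrightarrow> \<mu> \<and>
    (AE \<omega> in M. (\<lambda>n. S n \<omega> / real n) \<longlonglongrightarrow> \<mu>) \<and>
    (\<sigma>2 > 0 \<longrightarrow>
      (\<lambda>n. prob_space.variance M (S n) / real n) \<longlonglongrightarrow> \<sigma>2 \<and>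
      weak_conv_m (\<lambda>n. distr M borel (\<lambda>\<omega>. (S n \<omega> - real n * \<mu>) / sqrt (real n * \<sigma>2)))
        std_normal_distribution) \<and>
    (\<mu> = 0 \<and> \<sigma>2 > 0 \<longrightarrow>
      (AE \<omega> in M.
        -\<infinity> = liminf (\<lambda>n. ereal (S n \<omega>)) \<and>
        liminf (\<lambda>n. ereal (S n \<omega>)) < limsup (\<lambda>n. ereal (S n \<omega>)) \<and>
        limsup (\<lambda>n. ereal (S n \<omega>)) = \<infinity>))"
proof -
  interpret prob_space M using chain by (simp add: markov_chain_def)
  interpret ergodic_chain P p
    using chain irreducible aperiodic stationary by unfold_locales (simp_all add: markov_chain_def)
  define d where "d = martingale_part w"
  define h where "h = potential (drift w)"
  define r where "r = potential (\<lambda>i. cond_variance w i - \<sigma>2)"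
  obtain c where c: "\<And>ij. \<bar>case_prod d ij\<bar> \<le> c" using finite_bound[of "case_prod d"] by blast
  obtain R where R: "\<And>i. \<bar>r i\<bar> \<le> R" using finite_bound[of r] by blast
  obtain H where H: "\<And>i. \<bar>h i\<bar> \<le> H" using finite_bound[of h] by blast
  have "(\<Sum>i\<in>UNIV. p $ i * (cond_variance w i - \<sigma>2)) = 0"
    by (simp add: right_diff_distrib sum_subtractf sum_distrib_right[symmetric] p_sum
        \<sigma>2 asymptotic_variance_eq)
  from poisson_equation[OF this]
  have r_eq: "r i - (\<Sum>j\<in>UNIV. P $ i $ j * r j) = (\<Sum>j\<in>UNIV. P $ i $ j * (d i j)\<^sup>2) - \<sigma>2" for i
    by (simp add: r_def cond_variance_def d_def)
  have d0: "(\<Sum>j\<in>UNIV. P $ i $ j * d i j) = 0" for i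
    unfolding d_def by (rule martingale_part_centred)
  have dc: "\<bar>d i j\<bar> \<le> c" for i j using c[of "(i, j)"] by simp
  interpret W: markov_martingale M P X d r \<sigma>2 c R
    using chain d0 r_eq dc R by unfold_locales
  \<comment> \<open>Only the square of \<open>d\<close> enters the equation for \<open>r\<close>, so
    the same \<open>r\<close> and \<open>\<sigma>2\<close> serve for the negated martingale.\<close>
  interpret neg: markov_martingale M P X "\<lambda>i j. - d i j" r \<sigma>2 c R
    using d0 r_eq dc R by unfold_locales (simp_all add: sum_negf)
  have S_eq: "S n \<omega> = W.W n \<omega> + real n * \<mu> + (h (X 0 \<omega>) - h (X n \<omega>))" for n \<omega>
    unfolding S \<mu> d_def h_def by (rule partial_sum_decompose)
  have neg_eq: "neg.W n \<omega> = - W.W n \<omega>" for n \<omega>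
    by (simp add: partial_sum_def sum_negf)
  have B_le: "\<bar>h i - h j\<bar> \<le> 2 * H" for i j using H[of i] H[of j] by linarith
  have past_B: "W.past n (\<lambda>\<omega>. h (X 0 \<omega>) - h (X n \<omega>))" for n
    by (intro W.past_arith W.past_X_comp) auto
  have lim_B: "(\<lambda>n. b n / real n) \<longlonglongrightarrow> 0" if "\<And>n. \<bar>b n\<bar> \<le> 2 * H" for b :: "nat \<Rightarrow> real"
  proof (rule Lim_null_comparison)
    show "\<forall>\<^sub>F n in sequentially. norm (b n / real n) \<le> 2 * H / real n"
      using that by (intro always_eventually) (simp add: divide_right_mono)
    show "(\<lambda>n. 2 * H / real n) \<longlonglongrightarrow> 0" by (rule lim_const_over_n)
  qed
  have plus_\<mu>: "(\<lambda>n. (a n + real n * \<mu> + b n) / real n) \<longlonglongrightarrow> \<mu>"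
    if "(\<lambda>n. a n / real n) \<longlonglongrightarrow> 0" "\<And>n. \<bar>b n\<bar> \<le> 2 * H" for a b :: "nat \<Rightarrow> real"
  proof -
    have "(\<lambda>n. a n / real n + \<mu> + b n / real n) \<longlonglongrightarrow> 0 + \<mu> + 0"
      by (intro tendsto_intros that lim_B)
    moreover have "\<forall>\<^sub>F n in sequentially. a n / real n + \<mu> + b n / real n = (a n + real n * \<mu> + b n) / real n"
      using eventually_gt_at_top[of 0] by eventually_elim (simp add: add_divide_distrib)
    ultimately show ?thesis using Lim_transform_eventually by simp
  qed
  have mean: "(\<lambda>n. expectation (S n) / real n) \<longlonglongrightarrow> \<mu>"
  proof -
    have "expectation (S n) = 0 + real n * \<mu> + expectation (\<lambda>\<omega>. h (X 0 \<omega>) - h (X n \<omega>))" for n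
    proof -
      have "W.past n (W.W n)" by (rule W.past_partial_sum) simp
      note W.integrable_past[OF this] W.integrable_past[OF past_B, of n]
      moreover have "expectation (S n) =
          expectation (\<lambda>\<omega>. (W.W n \<omega> + real n * \<mu>) + (h (X 0 \<omega>) - h (X n \<omega>)))"
        by (intro Bochner_Integration.integral_cong refl) (rule S_eq)
      ultimately show ?thesis
        by (subst (asm) Bochner_Integration.integral_add) (auto simp: W.W_mean prob_space)
    qed
    moreover have "\<bar>expectation (\<lambda>\<omega>. h (X 0 \<omega>) - h (X n \<omega>))\<bar> \<le> 2 * H" for n
      using W.norm_expectation_le[OF past_B[of n], of "2 * H"] B_le by simp
    ultimately show ?thesis using plus_\<mu>[of "\<lambda>_. 0"] by simp
  qed
  have strong_law: "AE \<omega> in M. (\<lambda>n. S n \<omega> / real n) \<longlonglongrightarrow> \<mu>"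
    using W.W_strong_law by eventually_elim (unfold S_eq, rule plus_\<mu>, auto simp: B_le)
  have var: "(\<lambda>n. variance (S n) / real n) \<longlonglongrightarrow> \<sigma>2"
    using W.variance_limit[of h H \<mu>, OF H] by (simp only: S_eq[abs_def])
  have clt: "weak_conv_m (\<lambda>n. distr M borel (\<lambda>\<omega>. (S n \<omega> - real n * \<mu>) / sqrt (real n * \<sigma>2)))
      std_normal_distribution" if "0 < \<sigma>2"
    using W.central_limit[of h H, OF H that] by (simp add: S_eq)
  have oscillation: "AE \<omega> in M. -\<infinity> = liminf (\<lambda>n. ereal (S n \<omega>)) \<and>
        liminf (\<lambda>n. ereal (S n \<omega>)) < limsup (\<lambda>n. ereal (S n \<omega>)) \<and>
        limsup (\<lambda>n. ereal (S n \<omega>)) = \<infinity>" if "\<mu> = 0" "0 < \<sigma>2"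
    using W.W_unbounded_above[OF that(2)] neg.W_unbounded_above[OF that(2)]
  proof eventually_elim
    case (elim \<omega>)
    \<comment> \<open>A bounded discrepancy is absorbed by demanding the larger level
      \<open>K + nat \<lceil>2 * H\<rceil>\<close>. This carries unboundedness from the martingales
      to \<open>S\<close> and to its negative.\<close>
    have shift: "\<exists>n\<ge>K. real K \<le> g n"
      if f: "\<forall>K. \<exists>n\<ge>K. real K \<le> f n" and fg: "\<And>n. \<bar>g n - f n\<bar> \<le> 2 * H"
      for f g :: "nat \<Rightarrow> real" and K
    proof -
      obtain n where n: "n \<ge> K + nat \<lceil>2 * H\<rceil>" "real (K + nat \<lceil>2 * H\<rceil>) \<le> f n" using f by blast
      then show ?thesis using fg[of n] by (intro exI[of _ n]) (simp add: abs_le_iff, linarith)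
    qed
    have "limsup (\<lambda>n. ereal (S n \<omega>)) = \<infinity>"
      by (intro limsup_unbounded shift[OF elim(1)]) (simp add: S_eq that B_le)
    moreover have "limsup (\<lambda>n. ereal (- S n \<omega>)) = \<infinity>"
      by (intro limsup_unbounded shift[OF elim(2)]) (simp add: S_eq that neg_eq B_le abs_minus_commute)
    then have "- liminf (\<lambda>n. ereal (S n \<omega>)) = \<infinity>"
      using ereal_Limsup_uminus[of sequentially "\<lambda>n. ereal (S n \<omega>)"] by simp
    then have "liminf (\<lambda>n. ereal (S n \<omega>)) = -\<infinity>"
      by (metis ereal_uminus_uminus)
    ultimately show ?case by simp
  qed
  show ?thesis using mean strong_law var clt oscillation by blast
qed

end
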